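(* Let $n$ be a positive integer, let $\mathcal{M}$ be an $n$-abelian category and let $\mathcal{X}$ be the class of all $n$-exact sequences in $\mathcal{M}$. Then $(\mathcal{M},\mathcal{X})$ is an $n$-exact category.
   Context: Composition is written left to right. **$n$-exact sequences.** In an additive category $\mathcal{C}$, an $n$-cokernel of $d^0\colon X^0\to X^1$ is a sequence $(d^1,\dots,d^n)$, $X^1\to\cdots\to X^{n+1}$, such that $0\to\mathcal{C}(X^{n+1},Y)\to\cdots\to\mathcal{C}(X^1,Y)\to\mathcal{C}(X^0,Y)$ is exact for all $Y\in\mathcal{C}$; dually, an $n$-kernel of $d^n\colon X^n\to X^{n+1}$ is a sequence $(d^0,\dots,d^{n-1})$, $X^0\to\cdots\to X^n$, such that $0\to\mathcal{C}(Y,X^0)\to\cdots\to\mathcal{C}(Y,X^n)\to\mathcal{C}(Y,X^{n+1})$ is exact for all $Y$. An $n$-exact sequence is a complex $X^0\xrightarrow{d^0}\cdots\xrightarrow{d^n}X^{n+1}$ such that $(d^0,\dots,d^{n-1})$ is an $n$-kernel of $d^n$ and $(d^1,\dots,d^n)$ is an $n$-cokernel of $d^0$. A morphism $f$ of $n$-exact sequences (a morphism of complexes) is a weak isomorphism if $f^k$ and $f^{k+1}$ are isomorphisms for some $k\in\{0,\dots,n+1\}$, where $f^{n+2}:=f^0$. **$n$-abelian category.** An additive category $\mathcal{M}$ such that: (A0) $\mathcal{M}$ is idempotent complete; (A1) every morphism in $\mathcal{M}$ has an $n$-kernel and an $n$-cokernel; (A2) for every monomorphism $f^0\colon X^0\to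 X^1$ in $\mathcal{M}$ and every $n$-cokernel $(f^1,\dots,f^n)$ of $f^0$, the sequence $(f^0,f^1,\dots,f^n)$ is $n$-exact; (A2$^{\mathrm{op}}$) for every epimorphism $g^n\colon X^n\to X^{n+1}$ in $\mathcal{M}$ and every $n$-kernel $(g^0,\dots,g^{n-1})$ of $g^n$, the sequence $(g^0,\dots,g^n)$ is $n$-exact. **$n$-pushouts.** Given a complex $X\colon X^0\to\cdots\to X^n$ and $f^0\colon X^0\to Y^0$, an $n$-pushout diagram of $X$ along $f^0$ is a morphism of complexes $f\colon X\to Y$, $Y\colon Y^0\to\cdots\to Y^n$, extending $f^0$, such that in the mapping cone $X^0\xrightarrow{d_C^{-1}}X^1\oplus Y^0\xrightarrow{d_C^0}\cdots\to X^n\oplus Y^{n-1}\xrightarrow{d_C^{n-1}}Y^n$, with $d_C^k=\begin{bmatrix}-d_X^{k+1}&0\\ f^{k+1}&d_Y^k\end{bmatrix}$ (acting on columns; $X^{n+1}$ and $Y^{-1}$ are omitted), the sequence $(d_C^0,\dots,d_C^{n-1})$ is an $n$-cokernel of $d_C^{-1}$. $n$-pullback diagrams are dual. **$n$-exact category.** A pair $(\mathcal{M},\mathcal{X})$ with $\mathcal{M}$ additive and $\mathcal{X}$ a class of $n$-exact sequences in $\mathcal{M}$ (called admissible; first morphisms are admissible monomorphisms, last morphisms admissible epimorphisms), closed under weak isomorphisms of $n$-exact sequences, with: (E0) $0\to0\to\cdots\to0$ is in $\mathcal{X}$; (E1) admissible monomorphisms are closed under composition; (E1$^{\mathrm{op}}$)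 admissible epimorphisms are closed under composition; (E2) for each $X\in\mathcal{X}$ and each $f\colon X^0\to Y^0$ there is an $n$-pushout diagram of $(d_X^0,\dots,d_X^{n-1})$ along $f$ such that $d_Y^0$ is an admissible monomorphism; (E2$^{\mathrm{op}}$) for each $X\in\mathcal{X}$ and each $g\colon Y^{n+1}\to X^{n+1}$ there is an $n$-pullback diagram of $(d_X^1,\dots,d_X^n)$ along $g$ such that $d_Y^n$ is an admissible epimorphism. *)

theory Defs
  imports "HOL-Algebra.AbelCoset"
begin

section \<open>Additive categories\<close>

text \<open>
  A category enriched in abelian groups is given by a set of objects, hom-groups, identities and a
  composition.  As for modules in HOL-Algebra, the hom-groups are \<open>ring\<close> records of which only the
  additive part matters.  The hom-sets are not required to be disjoint, so a morphism is always
  considered together with its source and its target.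

  Composition is written left to right: \<open>f \<Zcomp> g\<close> is \<open>f\<close> followed by \<open>g\<close>.
\<close>

record ('o, 'm) precat =
  obj :: "'o set"
  mor :: "'o \<Rightarrow> 'o \<Rightarrow> 'm ring"
  ident :: "'o \<Rightarrow> 'm"
  cmp :: "'m \<Rightarrow> 'm \<Rightarrow> 'm"  (infixl \<open>\<Zcomp>\<index>\<close> 70)

abbreviation Hom :: "('o, 'm, 'x) precat_scheme \<Rightarrow> 'o \<Rightarrow> 'o \<Rightarrow> 'm set" where
  "Hom M A B \<equiv> carrier (mor M A B)"

locale category =
  fixes M :: "('o, 'm, 'x) precat_scheme" (structure)
  assumes ident_closed: "A \<in> obj M \<Longrightarrow> ident M A \<in> Hom M A A"
    and cmp_closed: "\<lbrakk>A \<in> obj M; B \<in> obj M; C \<in> obj M; f \<in> Hom M A B; g \<in> Hom M B C\<rbrakk>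
      \<Longrightarrow> f \<Zcomp> g \<in> Hom M A C"
    and ident_left: "\<lbrakk>A \<in> obj M; B \<in> obj M; f \<in> Hom M A B\<rbrakk> \<Longrightarrow> ident M A \<Zcomp> f = f"
    and ident_right: "\<lbrakk>A \<in> obj M; B \<in> obj M; f \<in> Hom M A B\<rbrakk> \<Longrightarrow> f \<Zcomp> ident M B = f"
    and cmp_assoc: "\<lbrakk>A \<in> obj M; B \<in> obj M; C \<in> obj M; D \<in> obj M;
        f \<in> Hom M A B; g \<in> Hom M B C; h \<in> Hom M C D\<rbrakk>
      \<Longrightarrow> (f \<Zcomp> g) \<Zcomp> h = f \<Zcomp> (g \<Zcomp> h)"

locale preadditive_category = category +
  assumes abelian_group_mor: "\<lbrakk>A \<in> obj M; B \<in> obj M\<rbrakk> \<Longrightarrow> abelian_group (mor M A B)"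
    and cmp_add_left: "\<lbrakk>A \<in> obj M; B \<in> obj M; C \<in> obj M;
        f \<in> Hom M A B; g \<in> Hom M A B; h \<in> Hom M B C\<rbrakk>
      \<Longrightarrow> (f \<oplus>\<^bsub>mor M A B\<^esub> g) \<Zcomp> h = (f \<Zcomp> h) \<oplus>\<^bsub>mor M A C\<^esub> (g \<Zcomp> h)"
    and cmp_add_right: "\<lbrakk>A \<in> obj M; B \<in> obj M; C \<in> obj M;
        f \<in> Hom M A B; g \<in> Hom M B C; h \<in> Hom M B C\<rbrakk>
      \<Longrightarrow> f \<Zcomp> (g \<oplus>\<^bsub>mor M B C\<^esub> h) = (f \<Zcomp> g) \<oplus>\<^bsub>mor M A C\<^esub> (f \<Zcomp> h)"

definition is_zero_object :: "('o, 'm, 'x) precat_scheme \<Rightarrow> 'o \<Rightarrow> bool" where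
  "is_zero_object M Z \<longleftrightarrow> Z \<in> obj M \<and>
    (\<forall>A \<in> obj M. (\<exists>!f. f \<in> Hom M A Z) \<and> (\<exists>!f. f \<in> Hom M Z A))"

record ('o, 'm) biprod =
  bp_ob :: 'o
  bp_inl :: 'm
  bp_inr :: 'm
  bp_prl :: 'm
  bp_prr :: 'm

definition is_biproduct ::
    "('o, 'm, 'x) precat_scheme \<Rightarrow> 'o \<Rightarrow> 'o \<Rightarrow> ('o, 'm) biprod \<Rightarrow> bool" where
  "is_biproduct M A B S \<longleftrightarrow>
    bp_ob S \<in> obj M \<and>
    bp_inl S \<in> Hom M A (bp_ob S) \<and> bp_inr S \<in> Hom M B (bp_ob S) \<and>
    bp_prl S \<in> Hom M (bp_ob S) A \<and> bp_prr S \<in> Hom M (bp_ob S) B \<and>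
    bp_inl S \<Zcomp>\<^bsub>M\<^esub> bp_prl S = ident M A \<and> bp_inr S \<Zcomp>\<^bsub>M\<^esub> bp_prr S = ident M B \<and>
    bp_inl S \<Zcomp>\<^bsub>M\<^esub> bp_prr S = \<zero>\<^bsub>mor M A B\<^esub> \<and> bp_inr S \<Zcomp>\<^bsub>M\<^esub> bp_prl S = \<zero>\<^bsub>mor M B A\<^esub> \<and>
    (bp_prl S \<Zcomp>\<^bsub>M\<^esub> bp_inl S) \<oplus>\<^bsub>mor M (bp_ob S) (bp_ob S)\<^esub> (bp_prr S \<Zcomp>\<^bsub>M\<^esub> bp_inr S)
      = ident M (bp_ob S)"

locale additive_category = preadditive_category +
  assumes ex_zero_object: "\<exists>Z. is_zero_object M Z"
    and ex_biproduct: "\<lbrakk>A \<in> obj M; B \<in> obj M\<rbrakk> \<Longrightarrow> \<exists>S. is_biproduct M A B S"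

text \<open>A fixed choice of the direct sum of two objects.\<close>

definition dsum :: "('o, 'm, 'x) precat_scheme \<Rightarrow> 'o \<Rightarrow> 'o \<Rightarrow> ('o, 'm) biprod" where
  "dsum M A B = (SOME S. is_biproduct M A B S)"

definition is_mono :: "('o, 'm, 'x) precat_scheme \<Rightarrow> 'o \<Rightarrow> 'o \<Rightarrow> 'm \<Rightarrow> bool" where
  "is_mono M A B f \<longleftrightarrow> f \<in> Hom M A B \<and>
    (\<forall>C \<in> obj M. \<forall>g \<in> Hom M C A. \<forall>h \<in> Hom M C A. g \<Zcomp>\<^bsub>M\<^esub> f = h \<Zcomp>\<^bsub>M\<^esub> f \<longrightarrow> g = h)"

definition is_epi :: "('o, 'm, 'x) precat_scheme \<Rightarrow> 'o \<Rightarrow> 'o \<Rightarrow> 'm \<Rightarrow> bool" where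
  "is_epi M A B f \<longleftrightarrow> f \<in> Hom M A B \<and>
    (\<forall>C \<in> obj M. \<forall>g \<in> Hom M B C. \<forall>h \<in> Hom M B C. f \<Zcomp>\<^bsub>M\<^esub> g = f \<Zcomp>\<^bsub>M\<^esub> h \<longrightarrow> g = h)"

definition is_isom :: "('o, 'm, 'x) precat_scheme \<Rightarrow> 'o \<Rightarrow> 'o \<Rightarrow> 'm \<Rightarrow> bool" where
  "is_isom M A B f \<longleftrightarrow> f \<in> Hom M A B \<and>
    (\<exists>g \<in> Hom M B A. f \<Zcomp>\<^bsub>M\<^esub> g = ident M A \<and> g \<Zcomp>\<^bsub>M\<^esub> f = ident M B)"

definition idempotent_complete :: "('o, 'm, 'x) precat_scheme \<Rightarrow> bool" where
  "idempotent_complete M \<longleftrightarrow>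
    (\<forall>A \<in> obj M. \<forall>e \<in> Hom M A A. e \<Zcomp>\<^bsub>M\<^esub> e = e \<longrightarrow>
      (\<exists>B \<in> obj M. \<exists>r \<in> Hom M A B. \<exists>s \<in> Hom M B A.
        r \<Zcomp>\<^bsub>M\<^esub> s = e \<and> s \<Zcomp>\<^bsub>M\<^esub> r = ident M B))"


section \<open>Complexes and \<open>n\<close>-exact sequences\<close>

text \<open>
  A finite sequence of morphisms \<open>ob 0 \<rightarrow> ob 1 \<rightarrow> \<dots> \<rightarrow> ob N\<close>, with \<open>diff k\<close> going from \<open>ob k\<close> to
  \<open>ob (k + 1)\<close>.  The bound \<open>N\<close> is a parameter of the predicates below; they ignore the values of
  \<open>ob\<close> and \<open>diff\<close> beyond it, so a sequence may be truncated by just lowering \<open>N\<close>.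
\<close>

record ('o, 'm) chain =
  ob :: "nat \<Rightarrow> 'o"
  diff :: "nat \<Rightarrow> 'm"

definition is_sequence :: "('o, 'm, 'x) precat_scheme \<Rightarrow> nat \<Rightarrow> ('o, 'm) chain \<Rightarrow> bool" where
  "is_sequence M N X \<longleftrightarrow>
    (\<forall>k \<le> N. ob X k \<in> obj M) \<and> (\<forall>k < N. diff X k \<in> Hom M (ob X k) (ob X (k + 1)))"

definition is_complex :: "('o, 'm, 'x) precat_scheme \<Rightarrow> nat \<Rightarrow> ('o, 'm) chain \<Rightarrow> bool" where
  "is_complex M N X \<longleftrightarrow> is_sequence M N X \<and>
    (\<forall>k. k + 1 < N \<longrightarrow>
      diff X k \<Zcomp>\<^bsub>M\<^esub> diff X (k + 1) = \<zero>\<^bsub>mor M (ob X k) (ob X (k + 2))\<^esub>)"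

definition is_chain_map ::
    "('o, 'm, 'x) precat_scheme \<Rightarrow> nat \<Rightarrow> ('o, 'm) chain \<Rightarrow> ('o, 'm) chain \<Rightarrow> (nat \<Rightarrow> 'm) \<Rightarrow> bool" where
  "is_chain_map M N X Y f \<longleftrightarrow> is_complex M N X \<and> is_complex M N Y \<and>
    (\<forall>k \<le> N. f k \<in> Hom M (ob X k) (ob Y k)) \<and>
    (\<forall>k < N. f k \<Zcomp>\<^bsub>M\<^esub> diff Y k = diff X k \<Zcomp>\<^bsub>M\<^esub> f (k + 1))"

text \<open>
  For a sequence \<open>X\<^sup>0 \<rightarrow> \<dots> \<rightarrow> X\<^sup>n\<^sup>+\<^sup>1\<close> with differentials \<open>d\<^sup>0, \<dots>, d\<^sup>n\<close>,
  \<open>is_n_cokernel M n X\<close> states that \<open>(d\<^sup>1, \<dots>, d\<^sup>n)\<close> is an \<open>n\<close>-cokernel of \<open>d\<^sup>0\<close>, i.e. that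
  \<open>0 \<rightarrow> M(X\<^sup>n\<^sup>+\<^sup>1, Y) \<rightarrow> \<dots> \<rightarrow> M(X\<^sup>0, Y)\<close> is exact for all \<open>Y\<close>, and
  \<open>is_n_kernel M n X\<close> states that \<open>(d\<^sup>0, \<dots>, d\<^sup>n\<^sup>-\<^sup>1)\<close> is an \<open>n\<close>-kernel of \<open>d\<^sup>n\<close>.
\<close>

definition is_n_cokernel :: "('o, 'm, 'x) precat_scheme \<Rightarrow> nat \<Rightarrow> ('o, 'm) chain \<Rightarrow> bool" where
  "is_n_cokernel M n X \<longleftrightarrow> is_sequence M (n + 1) X \<and>
    (\<forall>Y \<in> obj M.
      a_kernel (mor M (ob X (n + 1)) Y) (mor M (ob X n) Y) (\<lambda>g. diff X n \<Zcomp>\<^bsub>M\<^esub> g)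
        = {\<zero>\<^bsub>mor M (ob X (n + 1)) Y\<^esub>} \<and>
      (\<forall>k < n.
        a_kernel (mor M (ob X (k + 1)) Y) (mor M (ob X k) Y) (\<lambda>g. diff X k \<Zcomp>\<^bsub>M\<^esub> g)
          = (\<lambda>g. diff X (k + 1) \<Zcomp>\<^bsub>M\<^esub> g) ` Hom M (ob X (k + 2)) Y))"

definition is_n_kernel :: "('o, 'm, 'x) precat_scheme \<Rightarrow> nat \<Rightarrow> ('o, 'm) chain \<Rightarrow> bool" where
  "is_n_kernel M n X \<longleftrightarrow> is_sequence M (n + 1) X \<and>
    (\<forall>Y \<in> obj M.
      a_kernel (mor M Y (ob X 0)) (mor M Y (ob X 1)) (\<lambda>g. g \<Zcomp>\<^bsub>M\<^esub> diff X 0)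
        = {\<zero>\<^bsub>mor M Y (ob X 0)\<^esub>} \<and>
      (\<forall>k < n.
        a_kernel (mor M Y (ob X (k + 1))) (mor M Y (ob X (k + 2))) (\<lambda>g. g \<Zcomp>\<^bsub>M\<^esub> diff X (k + 1))
          = (\<lambda>g. g \<Zcomp>\<^bsub>M\<^esub> diff X k) ` Hom M Y (ob X k)))"

definition is_n_exact :: "('o, 'm, 'x) precat_scheme \<Rightarrow> nat \<Rightarrow> ('o, 'm) chain \<Rightarrow> bool" where
  "is_n_exact M n X \<longleftrightarrow> is_complex M (n + 1) X \<and> is_n_kernel M n X \<and> is_n_cokernel M n X"

text \<open>The index is cyclic, with \<open>f\<^sup>n\<^sup>+\<^sup>2 = f\<^sup>0\<close>.\<close>

definition is_weak_isomorphism ::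
    "('o, 'm, 'x) precat_scheme \<Rightarrow> nat \<Rightarrow> ('o, 'm) chain \<Rightarrow> ('o, 'm) chain \<Rightarrow> (nat \<Rightarrow> 'm) \<Rightarrow> bool" where
  "is_weak_isomorphism M n X Y f \<longleftrightarrow>
    is_n_exact M n X \<and> is_n_exact M n Y \<and> is_chain_map M (n + 1) X Y f \<and>
    (\<exists>k \<le> n + 1. let l = (k + 1) mod (n + 2) in
      is_isom M (ob X k) (ob Y k) (f k) \<and> is_isom M (ob X l) (ob Y l) (f l))"


section \<open>\<open>n\<close>-abelian categories\<close>

locale n_abelian_category = additive_category +
  fixes n :: nat
  assumes A0: "idempotent_complete M"
    and A1_kernel: "\<lbrakk>A \<in> obj M; B \<in> obj M; f \<in> Hom M A B\<rbrakk> \<Longrightarrow>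
      \<exists>X. ob X n = A \<and> ob X (n + 1) = B \<and> diff X n = f \<and> is_n_kernel M n X"
    and A1_cokernel: "\<lbrakk>A \<in> obj M; B \<in> obj M; f \<in> Hom M A B\<rbrakk> \<Longrightarrow>
      \<exists>X. ob X 0 = A \<and> ob X 1 = B \<and> diff X 0 = f \<and> is_n_cokernel M n X"
    and A2: "\<lbrakk>is_mono M (ob X 0) (ob X 1) (diff X 0); is_n_cokernel M n X\<rbrakk> \<Longrightarrow> is_n_exact M n X"
    and A2_op: "\<lbrakk>is_epi M (ob X n) (ob X (n + 1)) (diff X n); is_n_kernel M n X\<rbrakk>
      \<Longrightarrow> is_n_exact M n X"


section \<open>\<open>n\<close>-pushouts and \<open>n\<close>-pullbacks\<close>

text \<open>
  The mapping cone
  \<open>X\<^sup>0 \<rightarrow> X\<^sup>1 \<oplus> Y\<^sup>0 \<rightarrow> \<dots> \<rightarrow> X\<^sup>n \<oplus> Y\<^sup>n\<^sup>-\<^sup>1 \<rightarrow> Y\<^sup>n\<close> of a morphism of complexes \<open>f : X \<rightarrow> Y\<close>, for \<open>n \<ge> 1\<close>.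
  Usually its degrees run from \<open>-1\<close> to \<open>n\<close>; here they are shifted so as to start at \<open>0\<close>, hence
  \<open>diff k\<close> is the matrix with entries \<open>-d\<^sub>X\<^sup>k\<close>, \<open>f\<^sup>k\<close> and \<open>d\<^sub>Y\<^sup>k\<^sup>-\<^sup>1\<close>, restricted
  to \<open>X\<^sup>0\<close> in the first position and corestricted to \<open>Y\<^sup>n\<close> in the last one.
\<close>

definition mapping_cone ::
    "('o, 'm, 'x) precat_scheme \<Rightarrow> nat \<Rightarrow> ('o, 'm) chain \<Rightarrow> ('o, 'm) chain \<Rightarrow> (nat \<Rightarrow> 'm)
      \<Rightarrow> ('o, 'm) chain" where
  "mapping_cone M n X Y f =
    (let S = (\<lambda>k. dsum M (ob X k) (ob Y (k - 1)));
         C = (\<lambda>k. if k = 0 then ob X 0 else if k = n + 1 then ob Y n else bp_ob (S k));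
         neg_d = (\<lambda>k. \<ominus>\<^bsub>mor M (ob X k) (ob X (k + 1))\<^esub> diff X k)
     in \<lparr>ob = C,
         diff = (\<lambda>k.
           if k = 0 then
             (neg_d 0 \<Zcomp>\<^bsub>M\<^esub> bp_inl (S 1)) \<oplus>\<^bsub>mor M (C 0) (C 1)\<^esub> (f 0 \<Zcomp>\<^bsub>M\<^esub> bp_inr (S 1))
           else if k = n then
             (bp_prl (S n) \<Zcomp>\<^bsub>M\<^esub> f n) \<oplus>\<^bsub>mor M (C n) (C (n + 1))\<^esub>
             (bp_prr (S n) \<Zcomp>\<^bsub>M\<^esub> diff Y (n - 1))
           else
             (bp_prl (S k) \<Zcomp>\<^bsub>M\<^esub> neg_d k \<Zcomp>\<^bsub>M\<^esub> bp_inl (S (k + 1))) \<oplus>\<^bsub>mor M (C k) (C (k + 1))\<^esub>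
             (bp_prl (S k) \<Zcomp>\<^bsub>M\<^esub> f k \<Zcomp>\<^bsub>M\<^esub> bp_inr (S (k + 1))) \<oplus>\<^bsub>mor M (C k) (C (k + 1))\<^esub>
             (bp_prr (S k) \<Zcomp>\<^bsub>M\<^esub> diff Y (k - 1) \<Zcomp>\<^bsub>M\<^esub> bp_inr (S (k + 1))))\<rparr>)"

text \<open>\<open>f : X \<rightarrow> Y\<close> is an \<open>n\<close>-pushout diagram of \<open>X : X\<^sup>0 \<rightarrow> \<dots> \<rightarrow> X\<^sup>n\<close> along \<open>f\<^sup>0\<close>.\<close>

definition is_n_pushout ::
    "('o, 'm, 'x) precat_scheme \<Rightarrow> nat \<Rightarrow> ('o, 'm) chain \<Rightarrow> ('o, 'm) chain \<Rightarrow> (nat \<Rightarrow> 'm) \<Rightarrow> bool" where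
  "is_n_pushout M n X Y f \<longleftrightarrow>
    is_chain_map M n X Y f \<and> is_n_cokernel M n (mapping_cone M n X Y f)"

text \<open>
  \<open>g : Y \<rightarrow> X\<close> is an \<open>n\<close>-pullback diagram of \<open>X : X\<^sup>0 \<rightarrow> \<dots> \<rightarrow> X\<^sup>n\<close> along \<open>g\<^sup>n\<close>.  Dualizing
  the mapping cone literally would put the signs on the differentials of \<open>X\<close> instead of those
  of \<open>Y\<close>; both complexes are isomorphic.
\<close>

definition is_n_pullback ::
    "('o, 'm, 'x) precat_scheme \<Rightarrow> nat \<Rightarrow> ('o, 'm) chain \<Rightarrow> ('o, 'm) chain \<Rightarrow> (nat \<Rightarrow> 'm) \<Rightarrow> bool" where
  "is_n_pullback M n X Y g \<longleftrightarrow>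
    is_chain_map M n Y X g \<and> is_n_kernel M n (mapping_cone M n Y X g)"


section \<open>\<open>n\<close>-exact categories\<close>

definition adm_mono :: "('o, 'm) chain set \<Rightarrow> 'o \<Rightarrow> 'o \<Rightarrow> 'm \<Rightarrow> bool" where
  "adm_mono \<X> A B f \<longleftrightarrow> (\<exists>X \<in> \<X>. ob X 0 = A \<and> ob X 1 = B \<and> diff X 0 = f)"

definition adm_epi :: "nat \<Rightarrow> ('o, 'm) chain set \<Rightarrow> 'o \<Rightarrow> 'o \<Rightarrow> 'm \<Rightarrow> bool" where
  "adm_epi n \<X> A B f \<longleftrightarrow> (\<exists>X \<in> \<X>. ob X n = A \<and> ob X (n + 1) = B \<and> diff X n = f)"

text \<open>The sequence \<open>X\<^sup>1 \<rightarrow> X\<^sup>2 \<rightarrow> \<dots>\<close>, indexed from \<open>0\<close>.\<close>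

definition drop_first :: "('o, 'm) chain \<Rightarrow> ('o, 'm) chain" where
  "drop_first X = \<lparr>ob = (\<lambda>k. ob X (k + 1)), diff = (\<lambda>k. diff X (k + 1))\<rparr>"

text \<open>
  In \<open>E2\<close> the complex \<open>X\<^sup>0 \<rightarrow> \<dots> \<rightarrow> X\<^sup>n\<close> is \<open>X\<close> itself, read with the bound \<open>n\<close>.  In \<open>E2_op\<close>
  the complexes \<open>X\<^sup>1 \<rightarrow> \<dots> \<rightarrow> X\<^sup>n\<^sup>+\<^sup>1\<close> and \<open>Y\<^sup>1 \<rightarrow> \<dots> \<rightarrow> Y\<^sup>n\<^sup>+\<^sup>1\<close> are indexed from \<open>0\<close> to \<open>n\<close>.
\<close>

locale n_exact_category = additive_category M
  for M :: "('o, 'm, 'x) precat_scheme" (structure) +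
  fixes n :: nat and \<X> :: "('o, 'm) chain set"
  assumes n_exact: "X \<in> \<X> \<Longrightarrow> is_n_exact M n X"
    and weak_isomorphism_closed: "is_weak_isomorphism M n X Y F \<Longrightarrow> X \<in> \<X> \<longleftrightarrow> Y \<in> \<X>"
    and E0: "is_zero_object M Z \<Longrightarrow> \<lparr>ob = (\<lambda>_. Z), diff = (\<lambda>_. \<zero>\<^bsub>mor M Z Z\<^esub>)\<rparr> \<in> \<X>"
    and E1: "\<lbrakk>adm_mono \<X> A B f; adm_mono \<X> B C g\<rbrakk> \<Longrightarrow> adm_mono \<X> A C (f \<Zcomp> g)"
    and E1_op: "\<lbrakk>adm_epi n \<X> A B f; adm_epi n \<X> B C g\<rbrakk> \<Longrightarrow> adm_epi n \<X> A C (f \<Zcomp> g)"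
    and E2: "\<lbrakk>X \<in> \<X>; B \<in> obj M; f \<in> Hom M (ob X 0) B\<rbrakk> \<Longrightarrow>
      \<exists>Y F. is_n_pushout M n X Y F \<and> ob Y 0 = B \<and> F 0 = f \<and>
        adm_mono \<X> (ob Y 0) (ob Y 1) (diff Y 0)"
    and E2_op: "\<lbrakk>X \<in> \<X>; B \<in> obj M; g \<in> Hom M B (ob X (n + 1))\<rbrakk> \<Longrightarrow>
      \<exists>Y G. is_n_pullback M n (drop_first X) Y G \<and> ob Y n = B \<and> G n = g \<and>
        adm_epi n \<X> (ob Y (n - 1)) (ob Y n) (diff Y (n - 1))"

end

theory Submission
  imports Defs
begin

text \<open>
  The admissible monomorphisms turn out to be all monomorphisms: the first morphism of an
  \<open>n\<close>-exact sequence is mono because the sequence starts with an \<open>n\<close>-kernel, and conversely a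
  monomorphism followed by any of its \<open>n\<close>-cokernels is \<open>n\<close>-exact by A2 (\<open>adm_mono_iff\<close>).  Hence
  closure under composition is closure of monomorphisms under composition, and the content
  of the theorem is the existence of \<open>n\<close>-pushouts that preserve monomorphisms
  (\<open>ex_stepwise_pushout\<close>).  The statements on epimorphisms and \<open>n\<close>-pullbacks follow by applying
  these results to the opposite category, which is again \<open>n\<close>-abelian.

  The \<open>n\<close>-pushout of a complex \<open>X\<close> along \<open>f : X\<^sup>0 \<rightarrow> B\<close> is built from a single \<open>n\<close>-cokernel.  Its
  mapping cone has to begin with a morphism \<open>X\<^sup>0 \<rightarrow> X\<^sup>1 \<oplus> B\<close> with components \<open>d\<close> and \<open>f\<close>, up to signs;
  let \<open>Z\<close> be this morphism, with components \<open>d\<close> and \<open>-f\<close>, followed by an \<open>n\<close>-cokernel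
  \<open>X\<^sup>1 \<oplus> B \<rightarrow> Z\<^sup>2 \<rightarrow> \<dots> \<rightarrow> Z\<^sup>n\<^sup>+\<^sup>1\<close>.  The sequence \<open>Z\<close> has the right exactness but not the right shape,
  as the cone contains the objects \<open>X\<^sup>2, \<dots>, X\<^sup>n\<close>.  This is repaired by adding a contractible
  complex, one piece \<open>X\<^sup>k = X\<^sup>k\<close> for each \<open>k = 2, \<dots>, n\<close>: put \<open>Y\<^sup>0 = B\<close>, \<open>Y\<^sup>1 = Z\<^sup>2\<close> and
  \<open>Y\<^sup>k = Z\<^sup>k\<^sup>+\<^sup>1 \<oplus> X\<^sup>k\<close> for \<open>k \<ge> 2\<close>, so that \<open>X\<^sup>k \<oplus> Y\<^sup>k\<^sup>-\<^sup>1\<close> is \<open>Z\<^sup>k\<close> plus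
  the pieces that meet degree \<open>k\<close>, where the piece \<open>X\<^sup>k = X\<^sup>k\<close> lies in degrees \<open>k\<close> and \<open>k + 1\<close>.
  The projection \<open>X\<^sup>1 \<oplus> B \<rightarrow> X\<^sup>1\<close> extends to a chain map \<open>w : Z \<rightarrow> X\<close> by the factorization property of
  the \<open>n\<close>-cokernel (\<open>chain_map_extension\<close>), and this twists the differential of \<open>Y\<close>: on
  \<open>Z\<^sup>k\<^sup>+\<^sup>1\<close> it is \<open>(-d, w)\<close> and on \<open>X\<^sup>k\<close> it is \<open>(0, d)\<close>.  The morphism \<open>X \<rightarrow> Y\<close> is \<open>f\<close> in degree \<open>0\<close>, the
  inclusion \<open>X\<^sup>1 \<rightarrow> X\<^sup>1 \<oplus> B\<close> followed by \<open>X\<^sup>1 \<oplus> B \<rightarrow> Z\<^sup>2\<close> in degree \<open>1\<close>, and the inclusion of the second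
  summand afterwards.

  If \<open>X\<^sup>0 \<rightarrow> X\<^sup>1\<close> is mono, so is \<open>X\<^sup>0 \<rightarrow> X\<^sup>1 \<oplus> B\<close>, which by A2 is then a kernel of \<open>X\<^sup>1 \<oplus> B \<rightarrow> Z\<^sup>2\<close>.  A
  morphism \<open>u\<close> into \<open>B\<close> killed by \<open>B \<rightarrow> Z\<^sup>2\<close> therefore factors, as a morphism into \<open>X\<^sup>1 \<oplus> B\<close>, through
  some \<open>v\<close> into \<open>X\<^sup>0\<close>; the first component shows that \<open>v\<close> composed with \<open>X\<^sup>0 \<rightarrow> X\<^sup>1\<close> is zero, so \<open>v\<close> and \<open>u\<close> are
  zero.  Thus \<open>Y\<^sup>0 \<rightarrow> Y\<^sup>1\<close> is mono.
\<close>


section \<open>Calculating with morphisms\<close>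

context category
begin

text \<open>Since the hom-sets need not be disjoint, a typing judgement is carried along everywhere.\<close>

definition arr :: "'m \<Rightarrow> 'o \<Rightarrow> 'o \<Rightarrow> bool" where
  "arr f A B \<longleftrightarrow> A \<in> obj M \<and> B \<in> obj M \<and> f \<in> Hom M A B"

lemma arrD:
  assumes "arr f A B"
  shows "f \<in> Hom M A B" "A \<in> obj M" "B \<in> obj M"
  using assms by (auto simp: arr_def)

lemma arr_ident: "A \<in> obj M \<Longrightarrow> arr (ident M A) A A"
  by (simp add: arr_def ident_closed)

lemma arr_cmp: "\<lbrakk>arr f A B; arr g B C\<rbrakk> \<Longrightarrow> arr (f \<Zcomp> g) A C"
  unfolding arr_def using cmp_closed by blast

lemma ident_cmp: "arr f A B \<Longrightarrow> ident M A \<Zcomp> f = f"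
  unfolding arr_def using ident_left by blast

lemma cmp_ident: "arr f A B \<Longrightarrow> f \<Zcomp> ident M B = f"
  unfolding arr_def using ident_right by blast

lemma assoc: "\<lbrakk>arr f A B; arr g B C; arr h C D\<rbrakk> \<Longrightarrow> (f \<Zcomp> g) \<Zcomp> h = f \<Zcomp> (g \<Zcomp> h)"
  unfolding arr_def using cmp_assoc by blast

lemma arr_diff: "\<lbrakk>is_sequence M N X; k < N\<rbrakk> \<Longrightarrow> arr (diff X k) (ob X k) (ob X (Suc k))"
  by (auto simp: is_sequence_def arr_def)

end

context preadditive_category
begin

abbreviation hom_zero (\<open>\<zero>[_,_]\<close>) where "\<zero>[A,B] \<equiv> \<zero>\<^bsub>mor M A B\<^esub>"
abbreviation hom_add (\<open>(_ \<oplus>[_,_] _)\<close> [65, 0, 0, 66] 65) where "f \<oplus>[A,B] g \<equiv> f \<oplus>\<^bsub>mor M A B\<^esub> g"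
abbreviation hom_neg (\<open>\<ominus>[_,_] _\<close> [0, 0, 81] 80) where "\<ominus>[A,B] f \<equiv> \<ominus>\<^bsub>mor M A B\<^esub> f"

lemma arr_zero: "\<lbrakk>A \<in> obj M; B \<in> obj M\<rbrakk> \<Longrightarrow> arr \<zero>[A,B] A B"
  by (simp add: arr_def abelian_group.axioms(1) abelian_group_mor abelian_monoid.zero_closed)

lemma arr_add: "\<lbrakk>arr f A B; arr g A B\<rbrakk> \<Longrightarrow> arr (f \<oplus>[A,B] g) A B"
  by (simp add: arr_def abelian_group.axioms(1) abelian_group_mor abelian_monoid.a_closed)

lemma arr_neg: "arr f A B \<Longrightarrow> arr (\<ominus>[A,B] f) A B"
  by (simp add: arr_def abelian_group_mor abelian_group.a_inv_closed)

lemma add_cmp: "\<lbrakk>arr f A B; arr g A B; arr h B C\<rbrakk> \<Longrightarrow> (f \<oplus>[A,B] g) \<Zcomp> h = (f \<Zcomp> h) \<oplus>[A,C] (g \<Zcomp> h)"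
  unfolding arr_def using cmp_add_left by blast

lemma cmp_add: "\<lbrakk>arr f A B; arr g B C; arr h B C\<rbrakk> \<Longrightarrow> f \<Zcomp> (g \<oplus>[B,C] h) = (f \<Zcomp> g) \<oplus>[A,C] (f \<Zcomp> h)"
  unfolding arr_def using cmp_add_right by blast

lemma add_zero: "arr f A B \<Longrightarrow> f \<oplus>[A,B] \<zero>[A,B] = f"
  by (simp add: arr_def abelian_group.axioms(1) abelian_group_mor abelian_monoid.r_zero)

lemma zero_add: "arr f A B \<Longrightarrow> \<zero>[A,B] \<oplus>[A,B] f = f"
  by (simp add: arr_def abelian_group.axioms(1) abelian_group_mor abelian_monoid.l_zero)

lemma add_comm: "\<lbrakk>arr f A B; arr g A B\<rbrakk> \<Longrightarrow> f \<oplus>[A,B] g = g \<oplus>[A,B] f"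
  by (simp add: arr_def abelian_group.axioms(1) abelian_group_mor abelian_monoid.a_comm)

lemma neg_add_self: "arr f A B \<Longrightarrow> \<ominus>[A,B] f \<oplus>[A,B] f = \<zero>[A,B]"
  by (simp add: arr_def abelian_group_mor abelian_group.l_neg)

lemma neg_zero: "\<lbrakk>A \<in> obj M; B \<in> obj M\<rbrakk> \<Longrightarrow> \<ominus>[A,B] \<zero>[A,B] = \<zero>[A,B]"
  by (metis abelian_group.minus_equality abelian_group_mor add_zero arr_def arr_zero)

lemma neg_neg: "arr f A B \<Longrightarrow> \<ominus>[A,B] (\<ominus>[A,B] f) = f"
  by (simp add: arr_def abelian_group_mor abelian_group.minus_minus)

lemma neg_add_eq_zero_iff:
  assumes "arr f A B" "arr g A B"
  shows "\<ominus>[A,B] f \<oplus>[A,B] g = \<zero>[A,B] \<longleftrightarrow> g = f"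
proof -
  interpret abelian_group "mor M A B"
    using assms(1) by (simp add: abelian_group_mor arr_def)
  show ?thesis
    using assms by (metis arrD(1) a_inv_closed l_neg minus_equality minus_minus a_comm)
qed

text \<open>Recovers a value from the correction term by which the lift in the pushout argument is chosen.\<close>

lemma neg_add_cancel:
  assumes "arr f A B" "arr g A B"
  shows "\<ominus>[A,B] (f \<oplus>[A,B] \<ominus>[A,B] g) \<oplus>[A,B] f = g"
proof -
  interpret abelian_group "mor M A B"
    using assms(1) by (simp add: abelian_group_mor arr_def)
  show ?thesis
    using assms by (simp add: arr_def minus_add a_assoc a_comm[of "\<ominus>[A,B] f" g] l_neg)
qed

lemma cmp_zero:
  assumes "arr f A B" "C \<in> obj M"
  shows "f \<Zcomp> \<zero>[B,C] = \<zero>[A,C]"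
proof -
  interpret abelian_group "mor M A C"
    using assms by (simp add: abelian_group_mor arr_def)
  have z: "arr \<zero>[B,C] B C" "arr (f \<Zcomp> \<zero>[B,C]) A C"
    using assms by (blast intro: arr_zero arr_cmp dest: arrD)+
  then have "(f \<Zcomp> \<zero>[B,C]) \<oplus>[A,C] (f \<Zcomp> \<zero>[B,C]) = f \<Zcomp> \<zero>[B,C]"
    using cmp_add[OF assms(1) z(1) z(1)] by (simp add: add_zero)
  then show ?thesis
    using z(2) by (simp add: arrD(1))
qed

lemma zero_cmp:
  assumes "arr f B C" "A \<in> obj M"
  shows "\<zero>[A,B] \<Zcomp> f = \<zero>[A,C]"
proof -
  interpret abelian_group "mor M A C"
    using assms by (simp add: abelian_group_mor arr_def)
  have z: "arr \<zero>[A,B] A B" "arr (\<zero>[A,B] \<Zcomp> f) A C"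
    using assms by (blast intro: arr_zero arr_cmp dest: arrD)+
  then have "(\<zero>[A,B] \<Zcomp> f) \<oplus>[A,C] (\<zero>[A,B] \<Zcomp> f) = \<zero>[A,B] \<Zcomp> f"
    using add_cmp[OF z(1) z(1) assms(1)] by (simp add: add_zero)
  then show ?thesis
    using z(2) by (simp add: arrD(1))
qed

lemma cmp_neg:
  assumes "arr f A B" "arr g B C"
  shows "f \<Zcomp> (\<ominus>[B,C] g) = \<ominus>[A,C] (f \<Zcomp> g)"
proof -
  have "(f \<Zcomp> (\<ominus>[B,C] g)) \<oplus>[A,C] (f \<Zcomp> g) = \<zero>[A,C]"
    using assms by (metis cmp_add arr_neg neg_add_self cmp_zero arrD(3))
  then show ?thesis
    using assms by (metis abelian_group.minus_equality abelian_group_mor arr_cmp arr_neg arr_def)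
qed

lemma neg_cmp:
  assumes "arr f A B" "arr g B C"
  shows "(\<ominus>[A,B] f) \<Zcomp> g = \<ominus>[A,C] (f \<Zcomp> g)"
proof -
  have "((\<ominus>[A,B] f) \<Zcomp> g) \<oplus>[A,C] (f \<Zcomp> g) = \<zero>[A,C]"
    using assms by (metis add_cmp arr_neg neg_add_self zero_cmp arrD(2))
  then show ?thesis
    using assms by (metis abelian_group.minus_equality abelian_group_mor arr_cmp arr_neg arr_def)
qed

lemma mono_cancel_zero:
  assumes "is_mono M A B f" "arr u T A" "arr f A B" "u \<Zcomp> f = \<zero>[T,B]"
  shows "u = \<zero>[T,A]"
  using assms zero_cmp[OF assms(3), of T] arr_zero[of T A] unfolding is_mono_def by (auto simp: arr_def)

lemma mono_iff_cancel_zero: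
  assumes f: "arr f A B"
  shows "is_mono M A B f \<longleftrightarrow> (\<forall>T u. arr u T A \<longrightarrow> u \<Zcomp> f = \<zero>[T,B] \<longrightarrow> u = \<zero>[T,A])"
proof
  assume "is_mono M A B f"
  then show "\<forall>T u. arr u T A \<longrightarrow> u \<Zcomp> f = \<zero>[T,B] \<longrightarrow> u = \<zero>[T,A]"
    using mono_cancel_zero f by blast
next
  assume *: "\<forall>T u. arr u T A \<longrightarrow> u \<Zcomp> f = \<zero>[T,B] \<longrightarrow> u = \<zero>[T,A]"
  have "g = h" if g: "arr g T A" and h: "arr h T A" and eq: "g \<Zcomp> f = h \<Zcomp> f" for T g h
  proof -
    have "(\<ominus>[T,A] h \<oplus>[T,A] g) \<Zcomp> f = \<zero>[T,B]"
      using g h f eq by (simp add: add_cmp arr_neg neg_cmp neg_add_self arr_cmp)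
    then have "\<ominus>[T,A] h \<oplus>[T,A] g = \<zero>[T,A]"
      using * g h by (blast intro: arr_add arr_neg)
    then show ?thesis
      using g h neg_add_eq_zero_iff by blast
  qed
  then show "is_mono M A B f"
    unfolding is_mono_def using f by (auto simp: arr_def)
qed

end


section \<open>Direct sums\<close>

context preadditive_category
begin

lemma biproduct_arr:
  assumes "is_biproduct M A B S" "A \<in> obj M" "B \<in> obj M"
  shows "arr (bp_inl S) A (bp_ob S)" "arr (bp_inr S) B (bp_ob S)"
    "arr (bp_prl S) (bp_ob S) A" "arr (bp_prr S) (bp_ob S) B"
  using assms by (auto simp: is_biproduct_def arr_def)

lemma biproduct_eq:
  assumes "is_biproduct M A B S"
  shows "bp_inl S \<Zcomp> bp_prl S = ident M A" "bp_inr S \<Zcomp> bp_prr S = ident M B"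
    "bp_inl S \<Zcomp> bp_prr S = \<zero>[A,B]" "bp_inr S \<Zcomp> bp_prl S = \<zero>[B,A]"
    "(bp_prl S \<Zcomp> bp_inl S) \<oplus>[bp_ob S,bp_ob S] (bp_prr S \<Zcomp> bp_inr S) = ident M (bp_ob S)"
  using assms by (auto simp: is_biproduct_def)

definition cotuple where
  "cotuple S T a b = (bp_prl S \<Zcomp> a) \<oplus>[bp_ob S,T] (bp_prr S \<Zcomp> b)"

definition tuple where
  "tuple S T a b = (a \<Zcomp> bp_inl S) \<oplus>[T,bp_ob S] (b \<Zcomp> bp_inr S)"

lemma cotuple:
  assumes S: "is_biproduct M A B S" and a: "arr a A T" and b: "arr b B T"
  shows "arr (cotuple S T a b) (bp_ob S) T"
    "bp_inl S \<Zcomp> cotuple S T a b = a" "bp_inr S \<Zcomp> cotuple S T a b = b"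
proof -
  note s = biproduct_arr[OF S arrD(2)[OF a] arrD(2)[OF b]] and e = biproduct_eq[OF S]
  have p: "arr (bp_prl S \<Zcomp> a) (bp_ob S) T" "arr (bp_prr S \<Zcomp> b) (bp_ob S) T"
    using s a b arr_cmp by blast+
  then show "arr (cotuple S T a b) (bp_ob S) T"
    unfolding cotuple_def by (rule arr_add)
  show "bp_inl S \<Zcomp> cotuple S T a b = a"
    by (simp only: cotuple_def cmp_add[OF s(1) p] assoc[OF s(1,3) a, symmetric] assoc[OF s(1,4) b, symmetric] e(1-4)
        ident_cmp[OF a] ident_cmp[OF b] zero_cmp[OF a arrD(2)[OF b]] zero_cmp[OF b arrD(2)[OF a]] add_zero[OF a])
  show "bp_inr S \<Zcomp> cotuple S T a b = b"
    by (simp only: cotuple_def cmp_add[OF s(2) p] assoc[OF s(2,3) a, symmetric] assoc[OF s(2,4) b, symmetric] e(1-4)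
        ident_cmp[OF a] ident_cmp[OF b] zero_cmp[OF a arrD(2)[OF b]] zero_cmp[OF b arrD(2)[OF a]] zero_add[OF b])
qed

lemma tuple:
  assumes S: "is_biproduct M A B S" and a: "arr a T A" and b: "arr b T B"
  shows "arr (tuple S T a b) T (bp_ob S)"
    "tuple S T a b \<Zcomp> bp_prl S = a" "tuple S T a b \<Zcomp> bp_prr S = b"
proof -
  note s = biproduct_arr[OF S arrD(3)[OF a] arrD(3)[OF b]] and e = biproduct_eq[OF S]
  have p: "arr (a \<Zcomp> bp_inl S) T (bp_ob S)" "arr (b \<Zcomp> bp_inr S) T (bp_ob S)"
    using s a b arr_cmp by blast+
  then show "arr (tuple S T a b) T (bp_ob S)"
    unfolding tuple_def by (rule arr_add)
  show "tuple S T a b \<Zcomp> bp_prl S = a"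
    by (simp only: tuple_def add_cmp[OF p s(3)] assoc[OF a s(1,3)] assoc[OF b s(2,3)] e(1-4)
        cmp_ident[OF a] cmp_ident[OF b] cmp_zero[OF a arrD(3)[OF b]] cmp_zero[OF b arrD(3)[OF a]] add_zero[OF a])
  show "tuple S T a b \<Zcomp> bp_prr S = b"
    by (simp only: tuple_def add_cmp[OF p s(4)] assoc[OF a s(1,4)] assoc[OF b s(2,4)] e(1-4)
        cmp_ident[OF a] cmp_ident[OF b] cmp_zero[OF a arrD(3)[OF b]] cmp_zero[OF b arrD(3)[OF a]] zero_add[OF b])
qed

lemma tuple_cmp:
  assumes S: "is_biproduct M A B S" and a: "arr a T A" and b: "arr b T B" and u: "arr u (bp_ob S) U"
  shows "tuple S T a b \<Zcomp> u = (a \<Zcomp> (bp_inl S \<Zcomp> u)) \<oplus>[T,U] (b \<Zcomp> (bp_inr S \<Zcomp> u))"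
proof -
  note s = biproduct_arr[OF S arrD(3)[OF a] arrD(3)[OF b]]
  show ?thesis
    unfolding tuple_def add_cmp[OF arr_cmp[OF a s(1)] arr_cmp[OF b s(2)] u]
    by (simp add: assoc[OF a s(1) u] assoc[OF b s(2) u])
qed

lemma biproduct_coext:
  assumes S: "is_biproduct M A B S" and ob: "A \<in> obj M" "B \<in> obj M"
    and u: "arr u (bp_ob S) T" and v: "arr v (bp_ob S) T"
    and eq: "bp_inl S \<Zcomp> u = bp_inl S \<Zcomp> v" "bp_inr S \<Zcomp> u = bp_inr S \<Zcomp> v"
  shows "u = v"
proof -
  note s = biproduct_arr[OF S ob]
  have "x = (bp_prl S \<Zcomp> (bp_inl S \<Zcomp> x)) \<oplus>[bp_ob S,T] (bp_prr S \<Zcomp> (bp_inr S \<Zcomp> x))"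
    if x: "arr x (bp_ob S) T" for x
    by (simp only: add_cmp[OF arr_cmp[OF s(3,1)] arr_cmp[OF s(4,2)] x, symmetric] biproduct_eq(5)[OF S]
        assoc[OF s(3,1) x, symmetric] assoc[OF s(4,2) x, symmetric] ident_cmp[OF x])
  from this[OF u, unfolded eq] this[OF v, symmetric] show ?thesis by (rule trans)
qed

lemma biproduct_ext:
  assumes S: "is_biproduct M A B S" and ob: "A \<in> obj M" "B \<in> obj M"
    and u: "arr u T (bp_ob S)" and v: "arr v T (bp_ob S)"
    and eq: "u \<Zcomp> bp_prl S = v \<Zcomp> bp_prl S" "u \<Zcomp> bp_prr S = v \<Zcomp> bp_prr S"
  shows "u = v"
proof -
  note s = biproduct_arr[OF S ob]
  have "x = ((x \<Zcomp> bp_prl S) \<Zcomp> bp_inl S) \<oplus>[T,bp_ob S] ((x \<Zcomp> bp_prr S) \<Zcomp> bp_inr S)"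
    if x: "arr x T (bp_ob S)" for x
    by (simp only: cmp_add[OF x arr_cmp[OF s(3,1)] arr_cmp[OF s(4,2)], symmetric] biproduct_eq(5)[OF S]
        assoc[OF x s(3,1)] assoc[OF x s(4,2)] cmp_ident[OF x])
  from this[OF u, unfolded eq] this[OF v, symmetric] show ?thesis by (rule trans)
qed

end

lemma (in additive_category) dsum_biproduct:
  "\<lbrakk>A \<in> obj M; B \<in> obj M\<rbrakk> \<Longrightarrow> is_biproduct M A B (dsum M A B)"
  unfolding dsum_def using ex_biproduct by (rule someI_ex)


section \<open>Exactness in terms of morphisms\<close>

context preadditive_category
begin

text \<open>
  Since exactness at \<open>T = X\<^sup>k\<^sup>+\<^sup>2\<close> applied to the identity gives \<open>d d = 0\<close>, an \<open>n\<close>-cokernel is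
  automatically a complex; what remains is the factorization property at each middle term and the
  cancellation property at the end.
\<close>

lemma n_cokernel_iff:
  "is_n_cokernel M n X \<longleftrightarrow> is_complex M (n + 1) X \<and>
    (\<forall>T c. arr c (ob X (Suc n)) T \<longrightarrow> diff X n \<Zcomp> c = \<zero>[ob X n,T] \<longrightarrow> c = \<zero>[ob X (Suc n),T]) \<and>
    (\<forall>k<n. \<forall>T b. arr b (ob X (Suc k)) T \<longrightarrow> diff X k \<Zcomp> b = \<zero>[ob X k,T] \<longrightarrow>
      (\<exists>c. arr c (ob X (Suc (Suc k))) T \<and> diff X (Suc k) \<Zcomp> c = b))"
  (is "?L \<longleftrightarrow> ?C \<and> ?I \<and> ?E")
proof
  assume L: ?L
  then have seq: "is_sequence M (Suc n) X" by (simp add: is_n_cokernel_def)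
  have ob: "ob X k \<in> obj M" if "k \<le> Suc n" for k
    using seq that by (simp add: is_sequence_def)
  have "diff X k \<Zcomp> diff X (Suc k) = \<zero>[ob X k,ob X (Suc (Suc k))]" if k: "k < n" for k
  proof -
    have o: "ob X (Suc (Suc k)) \<in> obj M" using ob k by simp
    have "diff X (Suc k) \<Zcomp> ident M (ob X (Suc (Suc k)))
        \<in> a_kernel (mor M (ob X (k + 1)) (ob X (Suc (Suc k)))) (mor M (ob X k) (ob X (Suc (Suc k)))) (\<lambda>g. diff X k \<Zcomp> g)"
      using L k o ident_closed[OF o] by (auto simp: is_n_cokernel_def)
    moreover have "arr (diff X (Suc k)) (ob X (Suc k)) (ob X (Suc (Suc k)))"
      using arr_diff[OF seq] k by simp
    ultimately show ?thesis
      by (simp add: a_kernel_def' cmp_ident)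
  qed
  then have ?C using seq by (simp add: is_complex_def)
  moreover have ?I
    using L by (auto simp: is_n_cokernel_def a_kernel_def' arr_def)
  moreover have ?E
  proof (intro allI impI)
    fix k T b
    assume k: "k < n" and b: "arr b (ob X (Suc k)) T" and z: "diff X k \<Zcomp> b = \<zero>[ob X k,T]"
    have "a_kernel (mor M (ob X (k + 1)) T) (mor M (ob X k) T) (\<lambda>g. diff X k \<Zcomp> g)
        = (\<lambda>g. diff X (k + 1) \<Zcomp> g) ` Hom M (ob X (k + 2)) T"
      using L k arrD(3)[OF b] unfolding is_n_cokernel_def by blast
    moreover have "b \<in> a_kernel (mor M (ob X (k + 1)) T) (mor M (ob X k) T) (\<lambda>g. diff X k \<Zcomp> g)"
      using b z by (simp add: a_kernel_def' arr_def)
    ultimately have "b \<in> (\<lambda>g. diff X (Suc k) \<Zcomp> g) ` Hom M (ob X (Suc (Suc k))) T"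
      by simp
    then show "\<exists>c. arr c (ob X (Suc (Suc k))) T \<and> diff X (Suc k) \<Zcomp> c = b"
      using b k ob[of "Suc (Suc k)"] by (auto simp: arr_def)
  qed
  ultimately show "?C \<and> ?I \<and> ?E" by blast
next
  assume R: "?C \<and> ?I \<and> ?E"
  then have seq: "is_sequence M (Suc n) X" by (simp add: is_complex_def)
  have d: "arr (diff X k) (ob X k) (ob X (Suc k))" if "k \<le> n" for k
    using arr_diff[OF seq] that by simp
  have "a_kernel (mor M (ob X (Suc n)) T) (mor M (ob X n) T) (\<lambda>g. diff X n \<Zcomp> g) = {\<zero>[ob X (Suc n),T]}"
    (is "?K = _") if T: "T \<in> obj M" for T
  proof
    have o: "ob X (Suc n) \<in> obj M" using d[of n] by (simp add: arr_def)
    show "?K \<subseteq> {\<zero>[ob X (Suc n),T]}"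
    proof
      fix c assume "c \<in> ?K"
      then have "arr c (ob X (Suc n)) T" "diff X n \<Zcomp> c = \<zero>[ob X n,T]"
        using T o by (auto simp: a_kernel_def' arr_def)
      then show "c \<in> {\<zero>[ob X (Suc n),T]}" using R by blast
    qed
    show "{\<zero>[ob X (Suc n),T]} \<subseteq> ?K"
      using cmp_zero[OF d[of n] T] arrD(1)[OF arr_zero[OF o T]] by (simp add: a_kernel_def')
  qed
  moreover have "a_kernel (mor M (ob X (Suc k)) T) (mor M (ob X k) T) (\<lambda>g. diff X k \<Zcomp> g)
      = (\<lambda>g. diff X (Suc k) \<Zcomp> g) ` Hom M (ob X (Suc (Suc k))) T" (is "?K = ?J")
    if T: "T \<in> obj M" and k: "k < n" for T k
  proof
    have o: "ob X (Suc k) \<in> obj M" using d[of k] k by (simp add: arr_def)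
    show "?K \<subseteq> ?J"
    proof
      fix b assume "b \<in> ?K"
      then have "arr b (ob X (Suc k)) T" "diff X k \<Zcomp> b = \<zero>[ob X k,T]"
        using T o by (auto simp: a_kernel_def' arr_def)
      then obtain c where "arr c (ob X (Suc (Suc k))) T" "diff X (Suc k) \<Zcomp> c = b"
        using R k by blast
      then show "b \<in> ?J" by (auto simp: arr_def)
    qed
    show "?J \<subseteq> ?K"
    proof
      fix b assume "b \<in> ?J"
      then obtain c where c: "c \<in> Hom M (ob X (Suc (Suc k))) T" and b: "b = diff X (Suc k) \<Zcomp> c" by blast
      have d2: "arr (diff X k) (ob X k) (ob X (Suc k))" "arr (diff X (Suc k)) (ob X (Suc k)) (ob X (Suc (Suc k)))"
        using d[of k] d[of "Suc k"] k by auto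
      then have c': "arr c (ob X (Suc (Suc k))) T" using c T by (simp add: arr_def)
      have "diff X k \<Zcomp> diff X (Suc k) = \<zero>[ob X k,ob X (Suc (Suc k))]"
        using R k by (simp add: is_complex_def)
      then have "diff X k \<Zcomp> b = \<zero>[ob X k,T]"
        unfolding b assoc[OF d2 c', symmetric] using zero_cmp[OF c'] d2(1) by (simp add: arr_def)
      then show "b \<in> ?K" using arr_cmp[OF d2(2) c'] by (simp add: b a_kernel_def' arr_def)
    qed
  qed
  ultimately show ?L
    using seq by (simp add: is_n_cokernel_def)
qed

lemma n_cokernel_complex: "is_n_cokernel M n X \<Longrightarrow> is_complex M (n + 1) X"
  unfolding n_cokernel_iff by blast

lemma n_cokernel_factor:
  "\<lbrakk>is_n_cokernel M n X; k < n; arr b (ob X (Suc k)) T; diff X k \<Zcomp> b = \<zero>[ob X k,T]\<rbrakk>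
    \<Longrightarrow> \<exists>c. arr c (ob X (Suc (Suc k))) T \<and> diff X (Suc k) \<Zcomp> c = b"
  unfolding n_cokernel_iff by blast

lemma n_cokernel_cancel_last:
  "\<lbrakk>is_n_cokernel M n X; arr c (ob X (Suc n)) T; diff X n \<Zcomp> c = \<zero>[ob X n,T]\<rbrakk> \<Longrightarrow> c = \<zero>[ob X (Suc n),T]"
  unfolding n_cokernel_iff by blast

end


section \<open>The opposite category\<close>

definition opposite :: "('o, 'm, 'x) precat_scheme \<Rightarrow> ('o, 'm, 'x) precat_scheme" where
  "opposite M = M\<lparr>mor := \<lambda>A B. mor M B A, cmp := \<lambda>f g. g \<Zcomp>\<^bsub>M\<^esub> f\<rparr>"

lemma opposite_simps [simp]:
  "obj (opposite M) = obj M" "mor (opposite M) A B = mor M B A" "ident (opposite M) = ident M"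
  "f \<Zcomp>\<^bsub>opposite M\<^esub> g = g \<Zcomp>\<^bsub>M\<^esub> f" "opposite (opposite M) = M"
  by (simp_all add: opposite_def)

text \<open>
  Differential \<open>k\<close> of the reversed sequence is the original differential between positions
  \<open>N - k - 1\<close> and \<open>N - k\<close>.  Reversal is an involution only up to the values beyond \<open>N\<close>, which no
  predicate inspects.
\<close>

definition rev_chain :: "nat \<Rightarrow> ('o, 'm) chain \<Rightarrow> ('o, 'm) chain" where
  "rev_chain N X = \<lparr>ob = (\<lambda>k. ob X (N - k)), diff = (\<lambda>k. diff X (N - Suc k))\<rparr>"

lemma rev_chain_simps [simp]:
  "ob (rev_chain N X) k = ob X (N - k)" "diff (rev_chain N X) k = diff X (N - Suc k)"
  by (simp_all add: rev_chain_def)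

lemma all_le_rev: "(\<forall>k\<le>N. P (N - k)) \<longleftrightarrow> (\<forall>k\<le>(N::nat). P k)"
  by (metis diff_diff_cancel diff_le_self)

lemma all_less_rev: "(\<forall>k<N. P (N - Suc k)) \<longleftrightarrow> (\<forall>k<(N::nat). P k)"
proof
  assume *: "\<forall>k<N. P (N - Suc k)"
  show "\<forall>k<N. P k"
  proof (intro allI impI)
    fix k assume "k < N"
    then have "N - Suc k < N" "N - Suc (N - Suc k) = k" by auto
    then show "P k" using * by metis
  qed
qed auto

lemma is_sequence_opposite: "is_sequence (opposite M) N X \<longleftrightarrow> is_sequence M N (rev_chain N X)"
proof -
  have "(\<forall>k<N. diff X k \<in> Hom M (ob X (Suc k)) (ob X k))
      \<longleftrightarrow> (\<forall>k<N. diff X (N - Suc k) \<in> Hom M (ob X (Suc (N - Suc k))) (ob X (N - Suc k)))"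
    by (rule all_less_rev[symmetric])
  also have "\<dots> \<longleftrightarrow> (\<forall>k<N. diff X (N - Suc k) \<in> Hom M (ob X (N - k)) (ob X (N - Suc k)))"
    by (simp add: Suc_diff_Suc)
  finally show ?thesis
    using all_le_rev[of N "\<lambda>k. ob X k \<in> obj M"] by (simp add: is_sequence_def)
qed

lemma is_complex_opposite: "is_complex (opposite M) N X \<longleftrightarrow> is_complex M N (rev_chain N X)"
proof -
  have "(\<forall>k<N - 1. diff X (Suc k) \<Zcomp>\<^bsub>M\<^esub> diff X k = \<zero>\<^bsub>mor M (ob X (Suc (Suc k))) (ob X k)\<^esub>) \<longleftrightarrow>
     (\<forall>k<N - 1. diff X (Suc (N - 1 - Suc k)) \<Zcomp>\<^bsub>M\<^esub> diff X (N - 1 - Suc k)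
        = \<zero>\<^bsub>mor M (ob X (Suc (Suc (N - 1 - Suc k)))) (ob X (N - 1 - Suc k))\<^esub>)"
    by (rule all_less_rev[symmetric])
  also have "\<dots> \<longleftrightarrow> (\<forall>k<N - 1. diff X (N - Suc k) \<Zcomp>\<^bsub>M\<^esub> diff X (N - Suc (Suc k))
        = \<zero>\<^bsub>mor M (ob X (N - k)) (ob X (N - Suc (Suc k)))\<^esub>)"
    by (intro all_cong) (simp add: Suc_diff_Suc)
  finally show ?thesis
    by (simp add: is_complex_def is_sequence_opposite less_diff_conv)
qed

lemma is_chain_map_opposite:
  "is_chain_map (opposite M) N X Y f
    \<longleftrightarrow> is_chain_map M N (rev_chain N Y) (rev_chain N X) (\<lambda>k. f (N - k))"
proof -
  have "(\<forall>k<N. diff Y k \<Zcomp>\<^bsub>M\<^esub> f k = f (Suc k) \<Zcomp>\<^bsub>M\<^esub> diff X k)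
     \<longleftrightarrow> (\<forall>k<N. diff Y (N - Suc k) \<Zcomp>\<^bsub>M\<^esub> f (N - Suc k) = f (Suc (N - Suc k)) \<Zcomp>\<^bsub>M\<^esub> diff X (N - Suc k))"
    by (rule all_less_rev[symmetric])
  also have "\<dots> \<longleftrightarrow> (\<forall>k<N. f (N - k) \<Zcomp>\<^bsub>M\<^esub> diff X (N - Suc k) = diff Y (N - Suc k) \<Zcomp>\<^bsub>M\<^esub> f (N - Suc k))"
    by (intro all_cong) (auto simp: Suc_diff_Suc)
  finally show ?thesis
    using all_le_rev[of N "\<lambda>k. f k \<in> Hom M (ob Y k) (ob X k)"]
    by (auto simp: is_chain_map_def is_complex_opposite eq_commute)
qed

lemma is_n_cokernel_opposite: "is_n_cokernel (opposite M) n X \<longleftrightarrow> is_n_kernel M n (rev_chain (n + 1) X)"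
proof -
  have "(\<forall>k<n. a_kernel (mor M T (ob X (Suc k))) (mor M T (ob X k)) (\<lambda>g. g \<Zcomp>\<^bsub>M\<^esub> diff X k)
          = (\<lambda>g. g \<Zcomp>\<^bsub>M\<^esub> diff X (Suc k)) ` Hom M T (ob X (Suc (Suc k)))) \<longleftrightarrow>
     (\<forall>k<n. a_kernel (mor M T (ob X (Suc n - Suc k))) (mor M T (ob X (Suc n - Suc (Suc k))))
          (\<lambda>g. g \<Zcomp>\<^bsub>M\<^esub> diff X (Suc n - Suc (Suc k)))
        = (\<lambda>g. g \<Zcomp>\<^bsub>M\<^esub> diff X (Suc n - Suc k)) ` Hom M T (ob X (Suc n - k)))" (is "?L \<longleftrightarrow> ?R") for T
  proof -
    have "?L \<longleftrightarrow> (\<forall>k<n. a_kernel (mor M T (ob X (Suc (n - Suc k)))) (mor M T (ob X (n - Suc k)))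
          (\<lambda>g. g \<Zcomp>\<^bsub>M\<^esub> diff X (n - Suc k))
        = (\<lambda>g. g \<Zcomp>\<^bsub>M\<^esub> diff X (Suc (n - Suc k))) ` Hom M T (ob X (Suc (Suc (n - Suc k)))))"
      by (rule all_less_rev[symmetric])
    also have "\<dots> \<longleftrightarrow> ?R"
      by (intro all_cong) (simp add: Suc_diff_Suc Suc_diff_le)
    finally show ?thesis .
  qed
  then show ?thesis
    by (simp add: is_n_cokernel_def is_n_kernel_def is_sequence_opposite)
qed

lemma is_n_kernel_opposite: "is_n_kernel (opposite M) n X \<longleftrightarrow> is_n_cokernel M n (rev_chain (n + 1) X)"
proof -
  have "(\<forall>k<n. a_kernel (mor M (ob X (Suc k)) T) (mor M (ob X (Suc (Suc k))) T) (\<lambda>g. diff X (Suc k) \<Zcomp>\<^bsub>M\<^esub> g)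
          = (\<lambda>g. diff X k \<Zcomp>\<^bsub>M\<^esub> g) ` Hom M (ob X k) T) \<longleftrightarrow>
     (\<forall>k<n. a_kernel (mor M (ob X (Suc n - Suc k)) T) (mor M (ob X (Suc n - k)) T)
          (\<lambda>g. diff X (Suc n - Suc k) \<Zcomp>\<^bsub>M\<^esub> g)
        = (\<lambda>g. diff X (Suc n - Suc (Suc k)) \<Zcomp>\<^bsub>M\<^esub> g) ` Hom M (ob X (Suc n - Suc (Suc k))) T)"
    (is "?L \<longleftrightarrow> ?R") for T
  proof -
    have "?L \<longleftrightarrow> (\<forall>k<n. a_kernel (mor M (ob X (Suc (n - Suc k))) T) (mor M (ob X (Suc (Suc (n - Suc k)))) T)
          (\<lambda>g. diff X (Suc (n - Suc k)) \<Zcomp>\<^bsub>M\<^esub> g)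
        = (\<lambda>g. diff X (n - Suc k) \<Zcomp>\<^bsub>M\<^esub> g) ` Hom M (ob X (n - Suc k)) T)"
      by (rule all_less_rev[symmetric])
    also have "\<dots> \<longleftrightarrow> ?R"
      by (intro all_cong) (simp add: Suc_diff_Suc Suc_diff_le)
    finally show ?thesis .
  qed
  then show ?thesis
    by (simp add: is_n_cokernel_def is_n_kernel_def is_sequence_opposite)
qed

lemma is_n_exact_opposite: "is_n_exact (opposite M) n X \<longleftrightarrow> is_n_exact M n (rev_chain (n + 1) X)"
  using is_complex_opposite[of M "n + 1" X]
  by (auto simp: is_n_exact_def is_n_cokernel_opposite is_n_kernel_opposite)

lemma is_mono_opposite [simp]: "is_mono (opposite M) A B f \<longleftrightarrow> is_epi M B A f"
  and is_epi_opposite [simp]: "is_epi (opposite M) A B f \<longleftrightarrow> is_mono M B A f"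
  by (auto simp: is_mono_def is_epi_def)

context category
begin

lemma category_opposite: "category (opposite M)"
proof
  fix A B C D f g h
  assume "A \<in> obj (opposite M)" "B \<in> obj (opposite M)" "C \<in> obj (opposite M)" "D \<in> obj (opposite M)"
    "f \<in> Hom (opposite M) A B" "g \<in> Hom (opposite M) B C" "h \<in> Hom (opposite M) C D"
  then show "(f \<Zcomp>\<^bsub>opposite M\<^esub> g) \<Zcomp>\<^bsub>opposite M\<^esub> h = f \<Zcomp>\<^bsub>opposite M\<^esub> (g \<Zcomp>\<^bsub>opposite M\<^esub> h)"
    using cmp_assoc[of D C B A h g f] by simp
qed (simp_all add: ident_closed cmp_closed ident_left ident_right)

lemma arr_opposite: "category.arr (opposite M) f A B \<longleftrightarrow> arr f B A"
  by (auto simp: arr_def category.arr_def[OF category_opposite])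

end

lemma (in preadditive_category) preadditive_category_opposite: "preadditive_category (opposite M)"
proof -
  interpret O: category "opposite M" by (rule category_opposite)
  show ?thesis
    by (intro preadditive_category.intro preadditive_category_axioms.intro O.category_axioms)
      (simp_all add: abelian_group_mor cmp_add_left cmp_add_right)
qed

lemma (in additive_category) additive_category_opposite: "additive_category (opposite M)"
proof -
  interpret O: preadditive_category "opposite M" by (rule preadditive_category_opposite)
  show ?thesis
  proof
    have "is_zero_object (opposite M) Z" if "is_zero_object M Z" for Z
      using that by (simp add: is_zero_object_def)
    then show "\<exists>Z. is_zero_object (opposite M) Z"
      using ex_zero_object by blast
  next
    fix A B assume "A \<in> obj (opposite M)" "B \<in> obj (opposite M)"
    then obtain S where "is_biproduct M A B S" using ex_biproduct by auto
    then have "is_biproduct (opposite M) A B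
        \<lparr>bp_ob = bp_ob S, bp_inl = bp_prl S, bp_inr = bp_prr S, bp_prl = bp_inl S, bp_prr = bp_inr S\<rparr>"
      by (auto simp: is_biproduct_def)
    then show "\<exists>S. is_biproduct (opposite M) A B S" by blast
  qed
qed

lemma (in n_abelian_category) n_abelian_category_opposite: "n_abelian_category (opposite M) n"
proof -
  interpret O: additive_category "opposite M" by (rule additive_category_opposite)
  show ?thesis
  proof
    show "idempotent_complete (opposite M)"
      using A0 unfolding idempotent_complete_def by (simp, blast)
  next
    fix A B f assume "A \<in> obj (opposite M)" "B \<in> obj (opposite M)" "f \<in> Hom (opposite M) A B"
    then obtain X where X: "ob X 0 = B" "ob X 1 = A" "diff X 0 = f" "is_n_cokernel M n X"
      using A1_cokernel[of B A f] by auto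
    moreover have "is_n_kernel (opposite M) n (rev_chain (n + 1) X)"
      using X(4) is_n_cokernel_opposite[of "opposite M" n X] by simp
    ultimately show "\<exists>X. ob X n = A \<and> ob X (n + 1) = B \<and> diff X n = f \<and> is_n_kernel (opposite M) n X"
      by (intro exI[of _ "rev_chain (n + 1) X"]) simp
  next
    fix A B f assume "A \<in> obj (opposite M)" "B \<in> obj (opposite M)" "f \<in> Hom (opposite M) A B"
    then obtain X where X: "ob X n = B" "ob X (n + 1) = A" "diff X n = f" "is_n_kernel M n X"
      using A1_kernel[of B A f] by auto
    moreover have "is_n_cokernel (opposite M) n (rev_chain (n + 1) X)"
      using X(4) is_n_kernel_opposite[of "opposite M" n X] by simp
    ultimately show "\<exists>X. ob X 0 = A \<and> ob X 1 = B \<and> diff X 0 = f \<and> is_n_cokernel (opposite M) n X"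
      by (intro exI[of _ "rev_chain (n + 1) X"]) simp
  next
    fix X assume "is_mono (opposite M) (ob X 0) (ob X 1) (diff X 0)" "is_n_cokernel (opposite M) n X"
    then show "is_n_exact (opposite M) n X"
      using A2_op[of "rev_chain (n + 1) X"] by (simp add: is_n_cokernel_opposite is_n_exact_opposite)
  next
    fix X assume "is_epi (opposite M) (ob X n) (ob X (n + 1)) (diff X n)" "is_n_kernel (opposite M) n X"
    then show "is_n_exact (opposite M) n X"
      using A2[of "rev_chain (n + 1) X"] by (simp add: is_n_kernel_opposite is_n_exact_opposite)
  qed
qed

text \<open>The dual of \<open>n_cokernel_iff\<close>, read off from the reversed sequence in the opposite category.\<close>

lemma (in preadditive_category) n_kernel_iff:
  "is_n_kernel M n X \<longleftrightarrow> is_complex M (n + 1) X \<and>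
    (\<forall>T c. arr c T (ob X 0) \<longrightarrow> c \<Zcomp> diff X 0 = \<zero>[T,ob X (Suc 0)] \<longrightarrow> c = \<zero>[T,ob X 0]) \<and>
    (\<forall>k<n. \<forall>T b. arr b T (ob X (Suc k)) \<longrightarrow> b \<Zcomp> diff X (Suc k) = \<zero>[T,ob X (Suc (Suc k))] \<longrightarrow>
      (\<exists>c. arr c T (ob X k) \<and> c \<Zcomp> diff X k = b))"
proof -
  interpret O: preadditive_category "opposite M" by (rule preadditive_category_opposite)
  let ?R = "rev_chain (n + 1) X"
  define P where "P k \<longleftrightarrow> (\<forall>T b. arr b T (ob X (Suc k)) \<longrightarrow>
      b \<Zcomp> diff X (Suc k) = \<zero>[T,ob X (Suc (Suc k))] \<longrightarrow> (\<exists>c. arr c T (ob X k) \<and> c \<Zcomp> diff X k = b))" for k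
  have P: "(\<forall>T b. O.arr b (ob ?R (Suc k)) T \<longrightarrow> diff ?R k \<Zcomp>\<^bsub>opposite M\<^esub> b = \<zero>\<^bsub>mor (opposite M) (ob ?R k) T\<^esub> \<longrightarrow>
      (\<exists>c. O.arr c (ob ?R (Suc (Suc k))) T \<and> diff ?R (Suc k) \<Zcomp>\<^bsub>opposite M\<^esub> c = b)) \<longleftrightarrow> P (n - Suc k)"
    if "k < n" for k
    using that unfolding P_def by (simp add: arr_opposite Suc_diff_Suc Suc_diff_le)
  have "is_n_kernel M n X \<longleftrightarrow> is_n_cokernel (opposite M) n ?R"
    using is_n_kernel_opposite[of "opposite M" n X] by simp
  also have "\<dots> \<longleftrightarrow> is_complex M (n + 1) X \<and>
    (\<forall>T c. arr c T (ob X 0) \<longrightarrow> c \<Zcomp> diff X 0 = \<zero>[T,ob X (Suc 0)] \<longrightarrow> c = \<zero>[T,ob X 0]) \<and> (\<forall>k<n. P (n - Suc k))"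
    using is_complex_opposite[of "opposite M" "n + 1" X] P
    by (simp add: O.n_cokernel_iff arr_opposite)
  finally show ?thesis
    unfolding all_less_rev[of n P] by (simp add: P_def)
qed

lemma (in preadditive_category) n_kernel_factor:
  "\<lbrakk>is_n_kernel M n X; k < n; arr b T (ob X (Suc k)); b \<Zcomp> diff X (Suc k) = \<zero>[T,ob X (Suc (Suc k))]\<rbrakk>
    \<Longrightarrow> \<exists>c. arr c T (ob X k) \<and> c \<Zcomp> diff X k = b"
  unfolding n_kernel_iff by blast


section \<open>Chain maps\<close>

lemma is_complex_truncate: "\<lbrakk>is_complex M N X; L \<le> N\<rbrakk> \<Longrightarrow> is_complex M L X"
  by (auto simp: is_complex_def is_sequence_def)

context preadditive_category
begin

lemma complex_cmp:
  assumes "is_complex M N X" "Suc k < N"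
  shows "diff X k \<Zcomp> diff X (Suc k) = \<zero>[ob X k,ob X (Suc (Suc k))]"
  using assms by (simp add: is_complex_def)

lemma arr_diff_complex: "\<lbrakk>is_complex M N X; k < N\<rbrakk> \<Longrightarrow> arr (diff X k) (ob X k) (ob X (Suc k))"
  by (rule arr_diff[of N]) (simp_all add: is_complex_def)

lemma arr_chain_map: "\<lbrakk>is_chain_map M N X Y F; k \<le> N\<rbrakk> \<Longrightarrow> arr (F k) (ob X k) (ob Y k)"
  by (simp add: is_chain_map_def is_complex_def is_sequence_def arr_def)

lemma chain_map_comm:
  "\<lbrakk>is_chain_map M N X Y F; k < N\<rbrakk> \<Longrightarrow> F k \<Zcomp> diff Y k = diff X k \<Zcomp> F (Suc k)"
  by (simp add: is_chain_map_def)

lemma chain_map_complex: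
  assumes "is_chain_map M N X Y F"
  shows "is_complex M N X" "is_complex M N Y"
  using assms by (simp_all add: is_chain_map_def)

text \<open>
  A morphism defined in degrees \<open>0\<close> and \<open>1\<close> extends degree by degree: \<open>w\<^sup>k d\<close> is killed by the
  preceding differential of \<open>Z\<close>, because there it becomes \<open>w\<^sup>k\<^sup>-\<^sup>1 d d = 0\<close>, so it factors through the next one.
\<close>

lemma chain_map_extension:
  assumes Z: "is_n_cokernel M n Z" and X: "is_complex M N X" and N: "N \<le> n + 1" "0 < N"
    and u: "arr u (ob Z 0) (ob X 0)" and v: "arr v (ob Z 1) (ob X 1)"
    and uv: "u \<Zcomp> diff X 0 = diff Z 0 \<Zcomp> v"
  shows "\<exists>w. is_chain_map M N Z X w \<and> w 0 = u \<and> w 1 = v"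
  using N X
proof (induction N)
  case 0
  then show ?case by simp
next
  case (Suc N)
  have Zc: "is_complex M (n + 1) Z" using Z by (rule n_cokernel_complex)
  show ?case
  proof (cases "N = 0")
    case True
    have "is_complex M (Suc 0) Z"
      using Zc by (rule is_complex_truncate) simp
    then have "is_chain_map M (Suc 0) Z X (\<lambda>k. if k = 0 then u else v)"
      using u v uv Suc.prems(3) True by (auto simp: is_chain_map_def arr_def le_Suc_eq)
    then show ?thesis using True by (intro exI[of _ "\<lambda>k. if k = 0 then u else v"]) simp
  next
    case False
    then obtain m where m: "N = Suc m" using not0_implies_Suc by blast
    have "is_complex M N X" using Suc.prems(3) by (rule is_complex_truncate) simp
    then obtain w where w: "is_chain_map M N Z X w" "w 0 = u" "w 1 = v"
      using Suc.IH Suc.prems False by auto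
    have e: "arr (diff Z m) (ob Z m) (ob Z (Suc m))"
      and d: "arr (diff X m) (ob X m) (ob X (Suc m))" "arr (diff X (Suc m)) (ob X (Suc m)) (ob X (Suc (Suc m)))"
      using arr_diff_complex[OF Zc] arr_diff_complex[OF Suc.prems(3)] Suc.prems(1) m by auto
    have wm: "arr (w m) (ob Z m) (ob X m)" "arr (w (Suc m)) (ob Z (Suc m)) (ob X (Suc m))"
      using arr_chain_map[OF w(1)] m by auto
    have "diff Z m \<Zcomp> (w (Suc m) \<Zcomp> diff X (Suc m)) = (diff Z m \<Zcomp> w (Suc m)) \<Zcomp> diff X (Suc m)"
      by (rule assoc[OF e wm(2) d(2), symmetric])
    also have "\<dots> = (w m \<Zcomp> diff X m) \<Zcomp> diff X (Suc m)"
      using chain_map_comm[OF w(1)] m by simp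
    also have "\<dots> = w m \<Zcomp> (diff X m \<Zcomp> diff X (Suc m))"
      by (rule assoc[OF wm(1) d])
    also have "\<dots> = \<zero>[ob Z m,ob X (Suc (Suc m))]"
      using complex_cmp[OF Suc.prems(3), of m] m cmp_zero[OF wm(1) arrD(3)[OF d(2)]] by simp
    finally obtain c where c: "arr c (ob Z (Suc (Suc m))) (ob X (Suc (Suc m)))"
        "diff Z (Suc m) \<Zcomp> c = w (Suc m) \<Zcomp> diff X (Suc m)"
      using n_cokernel_factor[OF Z _ arr_cmp[OF wm(2) d(2)]] Suc.prems(1) m by auto
    have "is_complex M (Suc N) Z"
      using Zc Suc.prems(1) by (auto intro: is_complex_truncate)
    then have "is_chain_map M (Suc N) Z X (w(Suc N := c))"
      using w(1) c Suc.prems(3) m by (auto simp: is_chain_map_def arr_def le_Suc_eq less_Suc_eq)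
    moreover have "(w(Suc N := c)) 0 = u" "(w(Suc N := c)) 1 = v" using w(2,3) m by simp_all
    ultimately show ?thesis by blast
  qed
qed

text \<open>
  A condition on a chain map \<open>F : X \<rightarrow> Y\<close> that speaks of \<open>X\<close>, \<open>Y\<close> and \<open>F\<close> alone, without direct sums.
  A pair \<open>(a, b)\<close> of morphisms out of \<open>X\<^sup>k\<^sup>+\<^sup>1\<close> and \<open>Y\<^sup>k\<close> is a morphism out of a term of the mapping cone, and
  the equations on \<open>(a, b)\<close> say that it is killed by the preceding differential.  Factoring
  through the next term \<open>X\<^sup>k\<^sup>+\<^sup>2 \<oplus> Y\<^sup>k\<^sup>+\<^sup>1\<close> is asked for in the strong form where the component on
  \<open>X\<^sup>k\<^sup>+\<^sup>2\<close> vanishes.  As the condition does not depend on the signs in the cone or on the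
  choice of direct sums, it dualizes without change.
\<close>

definition is_stepwise_pushout where
  "is_stepwise_pushout n X Y F \<longleftrightarrow> is_chain_map M n X Y F \<and>
    (\<forall>T c. arr c (ob Y n) T \<longrightarrow> F n \<Zcomp> c = \<zero>[ob X n,T] \<longrightarrow> diff Y (n - 1) \<Zcomp> c = \<zero>[ob Y (n - 1),T]
      \<longrightarrow> c = \<zero>[ob Y n,T]) \<and>
    (\<forall>k<n. \<forall>T a b. arr a (ob X (Suc k)) T \<longrightarrow> arr b (ob Y k) T \<longrightarrow> F k \<Zcomp> b = diff X k \<Zcomp> a \<longrightarrow>
      (0 < k \<longrightarrow> diff Y (k - 1) \<Zcomp> b = \<zero>[ob Y (k - 1),T]) \<longrightarrow>
      (\<exists>c. arr c (ob Y (Suc k)) T \<and> F (Suc k) \<Zcomp> c = a \<and> diff Y k \<Zcomp> c = b))"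

lemma stepwise_pushout_chain_map: "is_stepwise_pushout n X Y F \<Longrightarrow> is_chain_map M n X Y F"
  by (simp add: is_stepwise_pushout_def)

end


section \<open>Mapping cones\<close>

text \<open>
  The mapping cone is handled through its coordinates.  The cone has the term \<open>X\<^sup>k \<oplus> Y\<^sup>k\<^sup>-\<^sup>1\<close> in degree
  \<open>k\<close>, with only the first summand for \<open>k = 0\<close> and only the second one for \<open>k = n + 1\<close>; taking
  identities as inclusions and projections there avoids special cases later.
\<close>

locale cone_of_chain_map = additive_category M
  for M :: "('o, 'm, 'x) precat_scheme" (structure) +
  fixes n :: nat and X Y :: "('o, 'm) chain" and F :: "nat \<Rightarrow> 'm"
  assumes n_pos: "0 < n" and chain_map: "is_chain_map M n X Y F"
begin

abbreviation C where "C \<equiv> mapping_cone M n X Y F"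
abbreviation S where "S k \<equiv> dsum M (ob X k) (ob Y (k - 1))"

text \<open>\<open>inX k\<close> and \<open>prX k\<close> concern degree \<open>k\<close> of the cone, but \<open>inY k\<close> and \<open>prY k\<close> concern degree \<open>k + 1\<close>.\<close>

definition inX where "inX k = (if k = 0 then ident M (ob X 0) else bp_inl (S k))"
definition prX where "prX k = (if k = 0 then ident M (ob X 0) else bp_prl (S k))"
definition inY where "inY k = (if k = n then ident M (ob Y n) else bp_inr (S (Suc k)))"
definition prY where "prY k = (if k = n then ident M (ob Y n) else bp_prr (S (Suc k)))"

text \<open>The restriction of the differential to the summand \<open>X\<^sup>k\<close>; see \<open>inX_diff\<close> below.\<close>

definition col where
  "col k = (if k = n then F n else tuple (S (Suc k)) (ob X k) (\<ominus>[ob X k,ob X (Suc k)] diff X k) (F k))"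

lemmas dX = arr_diff_complex[OF chain_map_complex(1)[OF chain_map]]
  and dY = arr_diff_complex[OF chain_map_complex(2)[OF chain_map]]
  and F = arr_chain_map[OF chain_map]
  and F_comm = chain_map_comm[OF chain_map]

lemma obX: "k \<le> n \<Longrightarrow> ob X k \<in> obj M" and obY: "k \<le> n \<Longrightarrow> ob Y k \<in> obj M"
  using F arrD by blast+

lemma S_biproduct: "\<lbrakk>0 < k; k \<le> n\<rbrakk> \<Longrightarrow> is_biproduct M (ob X k) (ob Y (k - 1)) (S k)"
  by (intro dsum_biproduct obX obY) auto

lemma ob_C: "ob C 0 = ob X 0" "k < n \<Longrightarrow> ob C (Suc k) = bp_ob (S (Suc k))" "ob C (Suc n) = ob Y n"
  by (simp_all add: mapping_cone_def Let_def)

lemma arr_inX: "k \<le> n \<Longrightarrow> arr (inX k) (ob X k) (ob C k)"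
  and arr_prX: "k \<le> n \<Longrightarrow> arr (prX k) (ob C k) (ob X k)"
  using biproduct_arr[OF S_biproduct[of k]] arr_ident[OF obX[of 0]] ob_C(1) ob_C(2)[of "k - 1"]
    obX[of k] obY[of "k - 1"]
  by (cases k; simp add: inX_def prX_def)+

lemma arr_inY: "k \<le> n \<Longrightarrow> arr (inY k) (ob Y k) (ob C (Suc k))"
  and arr_prY: "k \<le> n \<Longrightarrow> arr (prY k) (ob C (Suc k)) (ob Y k)"
  using biproduct_arr[OF S_biproduct[of "Suc k"]] arr_ident[OF obY[of n]] ob_C(2)[of k] ob_C(3)
    obX[of "Suc k"] obY[of k]
  by (cases "k = n"; simp add: inY_def prY_def)+

lemma cone_coext:
  assumes "k \<le> n + 1" "arr u (ob C k) T" "arr v (ob C k) T"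
    and "k \<le> n \<Longrightarrow> inX k \<Zcomp> u = inX k \<Zcomp> v" "0 < k \<Longrightarrow> inY (k - 1) \<Zcomp> u = inY (k - 1) \<Zcomp> v"
  shows "u = v"
proof -
  consider "k = 0" | j where "k = Suc j" "j < n" | "k = Suc n"
    using assms(1) by (cases k) (auto simp: le_less)
  then show ?thesis
  proof cases
    case 1
    then show ?thesis using assms by (simp add: inX_def ident_cmp ob_C)
  next
    case 2
    then show ?thesis
      using assms biproduct_coext[OF S_biproduct[of k] obX obY, of u T v]
      by (simp add: inX_def inY_def ob_C)
  next
    case 3
    then show ?thesis using assms n_pos by (simp add: inY_def ident_cmp ob_C)
  qed
qed

lemma cone_ext:
  assumes "k \<le> n + 1" "arr u T (ob C k)" "arr v T (ob C k)"
    and "k \<le> n \<Longrightarrow> u \<Zcomp> prX k = v \<Zcomp> prX k" "0 < k \<Longrightarrow> u \<Zcomp> prY (k - 1) = v \<Zcomp> prY (k - 1)"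
  shows "u = v"
proof -
  consider "k = 0" | j where "k = Suc j" "j < n" | "k = Suc n"
    using assms(1) by (cases k) (auto simp: le_less)
  then show ?thesis
  proof cases
    case 1
    then show ?thesis using assms by (simp add: prX_def cmp_ident ob_C)
  next
    case 2
    then show ?thesis
      using assms biproduct_ext[OF S_biproduct[of k] obX obY, of u T v]
      by (simp add: prX_def prY_def ob_C)
  next
    case 3
    then show ?thesis using assms n_pos by (simp add: prY_def cmp_ident ob_C)
  qed
qed

text \<open>
  The lifts required for exactness of the cone have a zero component on \<open>X\<close>, respectively on \<open>Y\<close>
  in the dual case.
\<close>

lemma ex_copair_zero:
  assumes "k \<le> n" "arr b (ob Y k) T"
  shows "\<exists>u. arr u (ob C (Suc k)) T \<and> inY k \<Zcomp> u = b \<and> (k < n \<longrightarrow> inX (Suc k) \<Zcomp> u = \<zero>[ob X (Suc k),T])"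
proof (cases "k = n")
  case True
  then show ?thesis using assms by (intro exI[of _ b]) (simp add: inY_def ident_cmp ob_C)
next
  case False
  then have k: "k < n" using assms by simp
  have "arr \<zero>[ob X (Suc k),T] (ob X (Suc k)) T" using k obX[of "Suc k"] assms(2) by (simp add: arr_zero arrD)
  from cotuple[OF S_biproduct[of "Suc k"], simplified, OF _ this assms(2)] show ?thesis
    using k by (auto simp: inX_def inY_def ob_C)
qed

lemma ex_pair_zero:
  assumes "k \<le> n" "arr a T (ob X k)"
  shows "\<exists>u. arr u T (ob C k) \<and> u \<Zcomp> prX k = a \<and> (0 < k \<longrightarrow> u \<Zcomp> prY (k - 1) = \<zero>[T,ob Y (k - 1)])"
proof (cases "k = 0")
  case True
  then show ?thesis using assms by (intro exI[of _ a]) (simp add: prX_def cmp_ident ob_C)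
next
  case False
  then obtain j where k: "k = Suc j" "j < n" using assms(1) by (cases k) auto
  have "arr \<zero>[T,ob Y j] T (ob Y j)" using k obY[of j] assms(2) by (simp add: arr_zero arrD)
  from tuple[OF S_biproduct[of k] assms(2)] this show ?thesis
    using k by (auto simp: prX_def prY_def ob_C)
qed

lemma arr_col: "k \<le> n \<Longrightarrow> arr (col k) (ob X k) (ob C (Suc k))"
  using tuple(1)[OF S_biproduct[of "Suc k"] arr_neg[OF dX[of k]]] F[of k]
  by (auto simp: col_def ob_C)

lemma col_prX: "k < n \<Longrightarrow> col k \<Zcomp> prX (Suc k) = \<ominus>[ob X k,ob X (Suc k)] diff X k"
  and col_prY: "k \<le> n \<Longrightarrow> col k \<Zcomp> prY k = F k"
  using tuple(2,3)[OF S_biproduct[of "Suc k"] arr_neg[OF dX[of k]]] F[of k]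
  by (auto simp: col_def prX_def prY_def cmp_ident)

lemma col_cmp:
  assumes "arr u (ob C (Suc k)) T"
  shows "k < n \<Longrightarrow> col k \<Zcomp> u =
      \<ominus>[ob X k,T] (diff X k \<Zcomp> (inX (Suc k) \<Zcomp> u)) \<oplus>[ob X k,T] (F k \<Zcomp> (inY k \<Zcomp> u))"
    and "k = n \<Longrightarrow> col k \<Zcomp> u = F k \<Zcomp> (inY k \<Zcomp> u)"
proof -
  assume k: "k < n"
  have "arr (inX (Suc k) \<Zcomp> u) (ob X (Suc k)) T"
    using arr_cmp[OF arr_inX assms] k by simp
  then show "col k \<Zcomp> u =
      \<ominus>[ob X k,T] (diff X k \<Zcomp> (inX (Suc k) \<Zcomp> u)) \<oplus>[ob X k,T] (F k \<Zcomp> (inY k \<Zcomp> u))"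
    using k tuple_cmp[OF S_biproduct[of "Suc k"] arr_neg[OF dX[of k]], of "F k" u T] F[of k] assms neg_cmp[OF dX[of k]]
    by (simp add: col_def inX_def inY_def ob_C)
next
  assume "k = n"
  then show "col k \<Zcomp> u = F k \<Zcomp> (inY k \<Zcomp> u)"
    using assms by (simp add: col_def inY_def ob_C ident_cmp)
qed

lemma diff_C_0: "diff C 0 = col 0"
  using n_pos by (simp add: mapping_cone_def Let_def col_def tuple_def)

lemma diff_C_Suc:
  assumes "k < n"
  shows "diff C (Suc k) = (prX (Suc k) \<Zcomp> col (Suc k)) \<oplus>[ob C (Suc k),ob C (Suc (Suc k))]
    (prY k \<Zcomp> (diff Y k \<Zcomp> inY (Suc k)))"
proof (cases "Suc k = n")
  case True
  then show ?thesis
    using dY[of k] by (auto simp: mapping_cone_def Let_def col_def prX_def prY_def inY_def cmp_ident)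
next
  case False
  then have k: "Suc k < n" using assms by simp
  let ?d = "\<ominus>[ob X (Suc k),ob X (Suc (Suc k))] diff X (Suc k)"
  let ?S = "S (Suc k)" and ?S' = "S (Suc (Suc k))"
  have S: "is_biproduct M (ob X (Suc k)) (ob Y k) ?S"
    using S_biproduct[of "Suc k"] k by simp
  have S': "is_biproduct M (ob X (Suc (Suc k))) (ob Y (Suc k)) ?S'"
    using S_biproduct[of "Suc (Suc k)"] k by simp
  note p = biproduct_arr[OF S obX obY] and i = biproduct_arr[OF S' obX obY]
  have d: "arr ?d (ob X (Suc k)) (ob X (Suc (Suc k)))" using arr_neg[OF dX] k by simp
  have F: "arr (F (Suc k)) (ob X (Suc k)) (ob Y (Suc k))" using F k by simp
  have dY: "arr (diff Y k) (ob Y k) (ob Y (Suc k))" using dY k by simp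
  have "(bp_prl ?S \<Zcomp> ?d \<Zcomp> bp_inl ?S') \<oplus>[bp_ob ?S,bp_ob ?S'] (bp_prl ?S \<Zcomp> F (Suc k) \<Zcomp> bp_inr ?S')
      = bp_prl ?S \<Zcomp> tuple ?S' (ob X (Suc k)) ?d (F (Suc k))"
    unfolding tuple_def using k p i d F
    by (simp add: cmp_add[of _ "bp_ob ?S" "ob X (Suc k)"] arr_cmp[of _ "ob X (Suc k)"]
        assoc[of _ "bp_ob ?S" "ob X (Suc k)"])
  moreover have "bp_prr ?S \<Zcomp> diff Y k \<Zcomp> bp_inr ?S' = bp_prr ?S \<Zcomp> (diff Y k \<Zcomp> bp_inr ?S')"
    using k p i dY by (simp add: assoc[of _ "bp_ob ?S" "ob Y k"])
  ultimately show ?thesis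
    using k by (simp add: mapping_cone_def Let_def col_def prX_def prY_def inY_def)
qed

lemma biproduct_cone:
  assumes "k < n"
  shows "inX (Suc k) \<Zcomp> prX (Suc k) = ident M (ob X (Suc k))" "inY k \<Zcomp> prY k = ident M (ob Y k)"
    "inX (Suc k) \<Zcomp> prY k = \<zero>[ob X (Suc k),ob Y k]" "inY k \<Zcomp> prX (Suc k) = \<zero>[ob Y k,ob X (Suc k)]"
  using biproduct_eq[OF S_biproduct[of "Suc k"]] assms by (simp_all add: inX_def inY_def prX_def prY_def)

lemma arr_diff_C:
  assumes "k \<le> n"
  shows "arr (diff C k) (ob C k) (ob C (Suc k))"
proof (cases k)
  case 0
  then show ?thesis using arr_col[of 0] by (simp add: diff_C_0 ob_C)
next
  case (Suc j)
  then have j: "j < n" using assms by simp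
  show ?thesis
    unfolding Suc diff_C_Suc[OF j] using j
    by (blast intro: arr_add arr_cmp arr_prX arr_col arr_prY dY arr_inY Suc_leI less_imp_le)
qed

lemma inX_diff: "k \<le> n \<Longrightarrow> inX k \<Zcomp> diff C k = col k"
proof (cases k)
  case 0
  then show ?thesis using arr_col[of 0] by (simp add: diff_C_0 inX_def ident_cmp ob_C)
next
  case (Suc j)
  assume "k \<le> n"
  then have j: "j < n" using Suc by simp
  have a: "arr (inX (Suc j)) (ob X (Suc j)) (ob C (Suc j))" "arr (prX (Suc j)) (ob C (Suc j)) (ob X (Suc j))"
    "arr (col (Suc j)) (ob X (Suc j)) (ob C (Suc (Suc j)))" "arr (prY j) (ob C (Suc j)) (ob Y j)"
    "arr (diff Y j \<Zcomp> inY (Suc j)) (ob Y j) (ob C (Suc (Suc j)))"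
    using j arr_inX arr_prX arr_col arr_prY arr_cmp[OF dY arr_inY, of j] by auto
  show ?thesis
    unfolding Suc diff_C_Suc[OF j] cmp_add[OF a(1) arr_cmp[OF a(2,3)] arr_cmp[OF a(4,5)]]
      assoc[OF a(1,2,3), symmetric] assoc[OF a(1,4,5), symmetric] biproduct_cone[OF j]
    using a arr_cmp by (simp add: ident_cmp zero_cmp[OF a(5)] add_zero arrD)
qed

lemma inY_diff: "k < n \<Longrightarrow> inY k \<Zcomp> diff C (Suc k) = diff Y k \<Zcomp> inY (Suc k)"
proof -
  assume j: "k < n"
  have a: "arr (inY k) (ob Y k) (ob C (Suc k))" "arr (prX (Suc k)) (ob C (Suc k)) (ob X (Suc k))"
    "arr (col (Suc k)) (ob X (Suc k)) (ob C (Suc (Suc k)))" "arr (prY k) (ob C (Suc k)) (ob Y k)"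
    "arr (diff Y k \<Zcomp> inY (Suc k)) (ob Y k) (ob C (Suc (Suc k)))"
    using j arr_inY arr_prX arr_col arr_prY arr_cmp[OF dY arr_inY, of k] by auto
  show ?thesis
    unfolding diff_C_Suc[OF j] cmp_add[OF a(1) arr_cmp[OF a(2,3)] arr_cmp[OF a(4,5)]]
      assoc[OF a(1,2,3), symmetric] assoc[OF a(1,4,5), symmetric] biproduct_cone[OF j]
    using a arr_cmp by (simp add: ident_cmp zero_cmp[OF a(3)] zero_add arrD)
qed

lemma diff_prX:
  assumes "k < n"
  shows "diff C k \<Zcomp> prX (Suc k) = \<ominus>[ob C k,ob X (Suc k)] (prX k \<Zcomp> diff X k)"
proof (cases k)
  case 0
  then show ?thesis
    using assms col_prX[of 0] dX[of 0] by (simp add: diff_C_0 prX_def ident_cmp ob_C)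
next
  case (Suc j)
  have a: "arr (prX k) (ob C k) (ob X k)" "arr (col k) (ob X k) (ob C (Suc k))" "arr (prX (Suc k)) (ob C (Suc k)) (ob X (Suc k))"
    "arr (prY j) (ob C k) (ob Y j)" "arr (diff Y j) (ob Y j) (ob Y k)" "arr (inY k) (ob Y k) (ob C (Suc k))"
    using Suc assms arr_prX arr_col arr_prY dY arr_inY by auto
  have z: "diff Y j \<Zcomp> (inY k \<Zcomp> prX (Suc k)) = \<zero>[ob Y j,ob X (Suc k)]"
    using biproduct_cone[OF assms] cmp_zero[OF a(5) arrD(3)[OF a(3)]] by simp
  have D: "diff C k = (prX k \<Zcomp> col k) \<oplus>[ob C k,ob C (Suc k)] (prY j \<Zcomp> (diff Y j \<Zcomp> inY k))"
    using diff_C_Suc[of j] Suc assms by simp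
  show ?thesis
    unfolding D add_cmp[OF arr_cmp[OF a(1,2)] arr_cmp[OF a(4) arr_cmp[OF a(5,6)]] a(3)]
      assoc[OF a(1,2,3)] assoc[OF a(4) arr_cmp[OF a(5,6)] a(3)] assoc[OF a(5,6,3)] z col_prX[OF assms]
      cmp_zero[OF a(4) arrD(3)[OF a(3)]] cmp_neg[OF a(1) dX[OF assms]]
    by (rule add_zero[OF arr_neg[OF arr_cmp[OF a(1) dX[OF assms]]]])
qed

lemma diff_prY_0: "diff C 0 \<Zcomp> prY 0 = F 0"
  using col_prY[of 0] by (simp add: diff_C_0)

lemma diff_prY:
  assumes "k < n"
  shows "diff C (Suc k) \<Zcomp> prY (Suc k)
    = (prX (Suc k) \<Zcomp> F (Suc k)) \<oplus>[ob C (Suc k),ob Y (Suc k)] (prY k \<Zcomp> diff Y k)"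
proof -
  let ?k = "Suc k"
  have a: "arr (prX ?k) (ob C ?k) (ob X ?k)" "arr (col ?k) (ob X ?k) (ob C (Suc ?k))" "arr (prY ?k) (ob C (Suc ?k)) (ob Y ?k)"
    "arr (prY k) (ob C ?k) (ob Y k)" "arr (diff Y k) (ob Y k) (ob Y ?k)" "arr (inY ?k) (ob Y ?k) (ob C (Suc ?k))"
    using assms arr_prX arr_col arr_prY dY arr_inY by auto
  have "inY ?k \<Zcomp> prY ?k = ident M (ob Y ?k)"
    using biproduct_cone(2)[of ?k] assms arr_ident[OF obY, of n] ident_cmp[of "ident M (ob Y n)"]
    by (cases "?k = n") (auto simp: inY_def prY_def)
  then have z: "diff Y k \<Zcomp> (inY ?k \<Zcomp> prY ?k) = diff Y k"
    using a(5) by (simp add: cmp_ident)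
  have c: "col ?k \<Zcomp> prY ?k = F ?k"
    using col_prY assms by simp
  show ?thesis
    unfolding diff_C_Suc[OF assms] add_cmp[OF arr_cmp[OF a(1,2)] arr_cmp[OF a(4) arr_cmp[OF a(5,6)]] a(3)]
      assoc[OF a(1,2,3)] assoc[OF a(4) arr_cmp[OF a(5,6)] a(3)] assoc[OF a(5,6,3)] z c ..
qed


lemma sequence_C: "is_sequence M (n + 1) C"
  unfolding is_sequence_def
proof (intro conjI allI impI)
  fix k assume "k \<le> n + 1"
  then show "ob C k \<in> obj M"
    using arrD(2)[OF arr_diff_C] arrD(3)[OF arr_diff_C[of n]] by (cases "k = n + 1") auto
next
  fix k assume "k < n + 1"
  then show "diff C k \<in> Hom M (ob C k) (ob C (k + 1))"
    using arrD(1)[OF arr_diff_C[of k]] by simp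
qed

lemma complex_C: "is_complex M (n + 1) C"
proof -
  have "diff C k \<Zcomp> diff C (Suc k) = \<zero>[ob C k,ob C (Suc (Suc k))]" if k: "k < n" for k
  proof (rule cone_ext[of "Suc (Suc k)"])
    have D: "arr (diff C k) (ob C k) (ob C (Suc k))" "arr (diff C (Suc k)) (ob C (Suc k)) (ob C (Suc (Suc k)))"
      using arr_diff_C k by auto
    show "arr (diff C k \<Zcomp> diff C (Suc k)) (ob C k) (ob C (Suc (Suc k)))"
      using D by (rule arr_cmp)
    show "arr \<zero>[ob C k,ob C (Suc (Suc k))] (ob C k) (ob C (Suc (Suc k)))"
      using D by (simp add: arr_zero arrD)
    have pX: "arr (prX k) (ob C k) (ob X k)" "arr (prX (Suc k)) (ob C (Suc k)) (ob X (Suc k))"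
      and d: "arr (diff X k) (ob X k) (ob X (Suc k))"
      and f: "arr (F k) (ob X k) (ob Y k)" "arr (F (Suc k)) (ob X (Suc k)) (ob Y (Suc k))"
      and pY: "arr (prY k) (ob C (Suc k)) (ob Y k)" "arr (prY (Suc k)) (ob C (Suc (Suc k))) (ob Y (Suc k))"
      and d': "arr (diff Y k) (ob Y k) (ob Y (Suc k))"
      using k arr_prX arr_prY dX dY F by auto
    note Dp = diff_prX[OF k]
    show "(diff C k \<Zcomp> diff C (Suc k)) \<Zcomp> prX (Suc (Suc k)) = \<zero>[ob C k,ob C (Suc (Suc k))] \<Zcomp> prX (Suc (Suc k))"
      if "Suc (Suc k) \<le> n"
    proof -
      have k': "Suc k < n" using that by simp
      have d2: "arr (diff X (Suc k)) (ob X (Suc k)) (ob X (Suc (Suc k)))" using dX k' by simp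
      have p: "arr (prX (Suc (Suc k))) (ob C (Suc (Suc k))) (ob X (Suc (Suc k)))" using arr_prX k' by simp
      have dd: "prX k \<Zcomp> diff X k \<Zcomp> diff X (Suc k) = \<zero>[ob C k,ob X (Suc (Suc k))]"
        using assoc[OF pX(1) d d2] complex_cmp[OF chain_map_complex(1)[OF chain_map] k']
          cmp_zero[OF pX(1) arrD(3)[OF d2]] by simp
      have "(diff C k \<Zcomp> diff C (Suc k)) \<Zcomp> prX (Suc (Suc k))
          = \<ominus>[ob C k,ob X (Suc (Suc k))] ((diff C k \<Zcomp> prX (Suc k)) \<Zcomp> diff X (Suc k))"
        using assoc[OF D p] diff_prX[OF k'] cmp_neg[OF D(1) arr_cmp[OF pX(2) d2]] assoc[OF D(1) pX(2) d2] by simp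
      also have "\<dots> = \<zero>[ob C k,ob X (Suc (Suc k))]"
        unfolding Dp neg_cmp[OF arr_cmp[OF pX(1) d] d2] dd
        using arrD(2)[OF D(1)] arrD(3)[OF d2] by (simp add: neg_zero)
      finally show ?thesis
        using zero_cmp[OF p arrD(2)[OF D(1)]] by simp
    qed
    have "diff C k \<Zcomp> prY k \<Zcomp> diff Y k = prX k \<Zcomp> F k \<Zcomp> diff Y k"
    proof (cases k)
      case 0
      then show ?thesis using f by (simp add: diff_prY_0 prX_def ident_cmp)
    next
      case (Suc j)
      then have j: "j < n" using k by simp
      have dj: "arr (diff Y j) (ob Y j) (ob Y k)" "arr (prY j) (ob C k) (ob Y j)"
        using j Suc dY arr_prY by auto
      have "prY j \<Zcomp> diff Y j \<Zcomp> diff Y k = \<zero>[ob C k,ob Y (Suc k)]"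
        using assoc[OF dj(2,1) d'] complex_cmp[OF chain_map_complex(2)[OF chain_map], of j] Suc k
          cmp_zero[OF dj(2) arrD(3)[OF d']] by simp
      then show ?thesis
        using diff_prY[OF j] Suc add_cmp[OF arr_cmp[OF pX(1) f(1)] arr_cmp[OF dj(2,1)] d']
          add_zero[OF arr_cmp[OF arr_cmp[OF pX(1) f(1)] d']] by simp
    qed
    then have eq: "diff C k \<Zcomp> prY k \<Zcomp> diff Y k = prX k \<Zcomp> diff X k \<Zcomp> F (Suc k)"
      using assoc[OF pX(1) f(1) d'] assoc[OF pX(1) d f(2)] F_comm[OF k] by simp
    have "(diff C k \<Zcomp> diff C (Suc k)) \<Zcomp> prY (Suc k)
        = (diff C k \<Zcomp> prX (Suc k) \<Zcomp> F (Suc k)) \<oplus>[ob C k,ob Y (Suc k)] (diff C k \<Zcomp> prY k \<Zcomp> diff Y k)"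
      unfolding assoc[OF D pY(2)] diff_prY[OF k] cmp_add[OF D(1) arr_cmp[OF pX(2) f(2)] arr_cmp[OF pY(1) d']]
        assoc[OF D(1) pX(2) f(2)] assoc[OF D(1) pY(1) d'] ..
    also have "\<dots> = \<zero>[ob C k,ob Y (Suc k)]"
      unfolding Dp eq neg_cmp[OF arr_cmp[OF pX(1) d] f(2)]
      by (rule neg_add_self[OF arr_cmp[OF arr_cmp[OF pX(1) d] f(2)]])
    finally show "(diff C k \<Zcomp> diff C (Suc k)) \<Zcomp> prY (Suc (Suc k) - 1)
        = \<zero>[ob C k,ob C (Suc (Suc k))] \<Zcomp> prY (Suc (Suc k) - 1)"
      using zero_cmp[OF pY(2) arrD(2)[OF D(1)]] by simp
  qed (use k in simp)
  then show ?thesis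
    using sequence_C by (simp add: is_complex_def)
qed

text \<open>
  The coordinates of a morphism \<open>u\<close> killed by a differential of the cone satisfy exactly the
  equations of \<open>is_stepwise_pushout\<close>, and the lift found there, extended by zero, is a lift of \<open>u\<close>.
\<close>

lemma stepwise_pushout_cone:
  assumes "is_stepwise_pushout n X Y F"
  shows "is_n_cokernel M n C"
  unfolding n_cokernel_iff
proof (intro conjI allI impI complex_C)
  fix T c
  assume c: "arr c (ob C (Suc n)) T" and z: "diff C n \<Zcomp> c = \<zero>[ob C n,T]"
  have c': "arr c (ob Y n) T" "inY n \<Zcomp> c = c" using c by (simp_all add: ob_C inY_def ident_cmp)
  have "inX n \<Zcomp> (diff C n \<Zcomp> c) = F n \<Zcomp> c"
    using assoc[OF arr_inX arr_diff_C c] inX_diff[of n] col_cmp(2)[OF c] c' by simp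
  then have "F n \<Zcomp> c = \<zero>[ob X n,T]"
    unfolding z using cmp_zero[OF arr_inX arrD(3)[OF c], of n] by simp
  moreover have "diff Y (n - 1) \<Zcomp> c = \<zero>[ob Y (n - 1),T]"
  proof -
    obtain m where m: "n = Suc m" using n_pos by (cases n) auto
    have a: "arr (inY m) (ob Y m) (ob C n)" "arr (diff C n) (ob C n) (ob C (Suc n))"
      "arr (diff Y m) (ob Y m) (ob Y n)" "arr (inY n) (ob Y n) (ob C (Suc n))"
      using m arr_inY arr_diff_C dY by auto
    have "inY m \<Zcomp> (diff C n \<Zcomp> c) = diff Y m \<Zcomp> c"
      using assoc[OF a(1,2) c] inY_diff[of m] assoc[OF a(3,4) c] c' m by simp
    then show ?thesis
      unfolding z using cmp_zero[OF a(1) arrD(3)[OF c]] m by simp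
  qed
  ultimately show "c = \<zero>[ob C (Suc n),T]"
    using assms c' unfolding is_stepwise_pushout_def by (simp add: ob_C)
next
  fix k T u
  assume k: "k < n" and u: "arr u (ob C (Suc k)) T" and z: "diff C k \<Zcomp> u = \<zero>[ob C k,T]"
  have i: "arr (inX k) (ob X k) (ob C k)" "arr (inX (Suc k)) (ob X (Suc k)) (ob C (Suc k))"
    "arr (inY k) (ob Y k) (ob C (Suc k))" "arr (inY (Suc k)) (ob Y (Suc k)) (ob C (Suc (Suc k)))"
    using k arr_inX arr_inY by auto
  have D: "arr (diff C k) (ob C k) (ob C (Suc k))" "arr (diff C (Suc k)) (ob C (Suc k)) (ob C (Suc (Suc k)))"
    and d: "arr (diff X k) (ob X k) (ob X (Suc k))" "arr (diff Y k) (ob Y k) (ob Y (Suc k))"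
    and f: "arr (F k) (ob X k) (ob Y k)"
    using k arr_diff_C dX dY F by auto
  define a b where "a = inX (Suc k) \<Zcomp> u" and "b = inY k \<Zcomp> u"
  have a: "arr a (ob X (Suc k)) T" and b: "arr b (ob Y k) T"
    using arr_cmp[OF i(2) u] arr_cmp[OF i(3) u] by (simp_all add: a_def b_def)
  have "inX k \<Zcomp> (diff C k \<Zcomp> u) = \<ominus>[ob X k,T] (diff X k \<Zcomp> a) \<oplus>[ob X k,T] (F k \<Zcomp> b)"
    using assoc[OF i(1) D(1) u] inX_diff[of k] col_cmp(1)[OF u k] k by (simp add: a_def b_def)
  then have ab: "F k \<Zcomp> b = diff X k \<Zcomp> a"
    unfolding z cmp_zero[OF i(1) arrD(3)[OF u]]
    using neg_add_eq_zero_iff[OF arr_cmp[OF d(1) a] arr_cmp[OF f b]] by simp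
  have "diff Y (k - 1) \<Zcomp> b = \<zero>[ob Y (k - 1),T]" if k0: "0 < k"
  proof -
    obtain j where j: "k = Suc j" using k0 by (cases k) auto
    have h: "arr (inY j) (ob Y j) (ob C k)" "arr (diff Y j) (ob Y j) (ob Y k)"
      using k j arr_inY dY by auto
    have "inY j \<Zcomp> (diff C k \<Zcomp> u) = diff Y j \<Zcomp> b"
      using assoc[OF h(1) D(1) u] inY_diff[of j] assoc[OF h(2) i(3) u] j k by (simp add: b_def)
    then show ?thesis
      unfolding z using cmp_zero[OF h(1) arrD(3)[OF u]] j by simp
  qed
  then obtain c where c: "arr c (ob Y (Suc k)) T" "F (Suc k) \<Zcomp> c = a" "diff Y k \<Zcomp> c = b"
    using assms k a b ab unfolding is_stepwise_pushout_def by blast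
  obtain v where v: "arr v (ob C (Suc (Suc k))) T" "inY (Suc k) \<Zcomp> v = c"
    and v0: "Suc k < n \<Longrightarrow> inX (Suc (Suc k)) \<Zcomp> v = \<zero>[ob X (Suc (Suc k)),T]"
    using ex_copair_zero[OF _ c(1)] k by auto
  have "diff C (Suc k) \<Zcomp> v = u"
  proof (rule cone_coext[of "Suc k"])
    show "arr (diff C (Suc k) \<Zcomp> v) (ob C (Suc k)) T" using D(2) v(1) by (rule arr_cmp)
    have "col (Suc k) \<Zcomp> v = a"
    proof (cases "Suc k = n")
      case True
      then show ?thesis using col_cmp(2)[OF v(1)] v(2) c(2) by simp
    next
      case False
      then have k': "Suc k < n" using k by simp
      have "diff X (Suc k) \<Zcomp> \<zero>[ob X (Suc (Suc k)),T] = \<zero>[ob X (Suc k),T]"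
        using cmp_zero[OF dX[OF k'] arrD(3)[OF a]] .
      then show ?thesis
        using col_cmp(1)[OF v(1) k'] v(2) v0[OF k'] c(2) a by (simp add: neg_zero zero_add arrD)
    qed
    then show "inX (Suc k) \<Zcomp> (diff C (Suc k) \<Zcomp> v) = inX (Suc k) \<Zcomp> u"
      using assoc[OF i(2) D(2) v(1)] inX_diff[of "Suc k"] k by (simp add: a_def)
    show "inY (Suc k - 1) \<Zcomp> (diff C (Suc k) \<Zcomp> v) = inY (Suc k - 1) \<Zcomp> u"
      using assoc[OF i(3) D(2) v(1)] inY_diff[OF k] assoc[OF d(2) i(4) v(1)] v(2) c(3) by (simp add: b_def)
  qed (use k u in simp_all)
  then show "\<exists>c. arr c (ob C (Suc (Suc k))) T \<and> diff C (Suc k) \<Zcomp> c = u"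
    using v(1) by blast
qed

text \<open>
  The dual criterion for the same cone.  Here the sign of the differential of \<open>X\<close> matters: the first
  coordinate \<open>b\<close> of \<open>u\<close> has to be negated before the hypothesis applies.
\<close>

lemma stepwise_pullback_cone:
  assumes mono: "\<And>T c. \<lbrakk>arr c T (ob X 0); c \<Zcomp> F 0 = \<zero>[T,ob Y 0]; c \<Zcomp> diff X 0 = \<zero>[T,ob X (Suc 0)]\<rbrakk>
      \<Longrightarrow> c = \<zero>[T,ob X 0]"
    and lift: "\<And>k T a b. \<lbrakk>k < n; arr a T (ob Y k); arr b T (ob X (Suc k)); b \<Zcomp> F (Suc k) = a \<Zcomp> diff Y k;
        Suc k < n \<Longrightarrow> b \<Zcomp> diff X (Suc k) = \<zero>[T,ob X (Suc (Suc k))]\<rbrakk>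
      \<Longrightarrow> \<exists>c. arr c T (ob X k) \<and> c \<Zcomp> F k = a \<and> c \<Zcomp> diff X k = b"
  shows "is_n_kernel M n C"
  unfolding n_kernel_iff
proof (intro conjI allI impI complex_C)
  fix T c
  assume c: "arr c T (ob C 0)" and z: "c \<Zcomp> diff C 0 = \<zero>[T,ob C (Suc 0)]"
  have c': "arr c T (ob X 0)" using c by (simp add: ob_C)
  have a: "arr (diff C 0) (ob C 0) (ob C (Suc 0))" "arr (prX (Suc 0)) (ob C (Suc 0)) (ob X (Suc 0))"
    "arr (prY 0) (ob C (Suc 0)) (ob Y 0)" "arr (diff X 0) (ob X 0) (ob X (Suc 0))"
    using arr_diff_C[of 0] arr_prX[of "Suc 0"] arr_prY[of 0] dX[of 0] n_pos by auto
  have "c \<Zcomp> F 0 = (c \<Zcomp> diff C 0) \<Zcomp> prY 0"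
    using assoc[OF c a(1,3)] by (simp add: diff_prY_0)
  then have 1: "c \<Zcomp> F 0 = \<zero>[T,ob Y 0]"
    unfolding z using zero_cmp[OF a(3) arrD(2)[OF c]] by simp
  have "diff C 0 \<Zcomp> prX (Suc 0) = \<ominus>[ob X 0,ob X (Suc 0)] diff X 0"
    using col_prX[OF n_pos] by (simp add: diff_C_0)
  then have "\<ominus>[T,ob X (Suc 0)] (c \<Zcomp> diff X 0) = (c \<Zcomp> diff C 0) \<Zcomp> prX (Suc 0)"
    using assoc[OF c a(1,2)] cmp_neg[OF c' a(4)] by simp
  then have "\<ominus>[T,ob X (Suc 0)] (c \<Zcomp> diff X 0) = \<zero>[T,ob X (Suc 0)]"
    unfolding z using zero_cmp[OF a(2) arrD(2)[OF c]] by simp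
  then have 2: "c \<Zcomp> diff X 0 = \<zero>[T,ob X (Suc 0)]"
    using neg_neg[OF arr_cmp[OF c' a(4)]] neg_zero[OF arrD(2)[OF c] arrD(3)[OF a(2)]] by simp
  show "c = \<zero>[T,ob C 0]"
    using mono[OF c' 1 2] by (simp add: ob_C)
next
  fix k T u
  assume k: "k < n" and u: "arr u T (ob C (Suc k))" and z: "u \<Zcomp> diff C (Suc k) = \<zero>[T,ob C (Suc (Suc k))]"
  have p: "arr (prX k) (ob C k) (ob X k)" "arr (prX (Suc k)) (ob C (Suc k)) (ob X (Suc k))"
    "arr (prY k) (ob C (Suc k)) (ob Y k)" "arr (prY (Suc k)) (ob C (Suc (Suc k))) (ob Y (Suc k))"
    using k arr_prX arr_prY by auto
  have D: "arr (diff C k) (ob C k) (ob C (Suc k))" "arr (diff C (Suc k)) (ob C (Suc k)) (ob C (Suc (Suc k)))"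
    and d: "arr (diff X k) (ob X k) (ob X (Suc k))" "arr (diff Y k) (ob Y k) (ob Y (Suc k))"
    and f: "arr (F k) (ob X k) (ob Y k)" "arr (F (Suc k)) (ob X (Suc k)) (ob Y (Suc k))"
    using k arr_diff_C dX dY F by auto
  have T: "T \<in> obj M" using u by (rule arrD)
  define a b where "a = u \<Zcomp> prY k" and "b = u \<Zcomp> prX (Suc k)"
  have a: "arr a T (ob Y k)" and b: "arr b T (ob X (Suc k))"
    using arr_cmp[OF u p(3)] arr_cmp[OF u p(2)] by (simp_all add: a_def b_def)
  have bF: "arr (b \<Zcomp> F (Suc k)) T (ob Y (Suc k))" and ad: "arr (a \<Zcomp> diff Y k) T (ob Y (Suc k))"
    using b f a d arr_cmp by blast+
  have "(u \<Zcomp> diff C (Suc k)) \<Zcomp> prY (Suc k) = (b \<Zcomp> F (Suc k)) \<oplus>[T,ob Y (Suc k)] (a \<Zcomp> diff Y k)"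
    unfolding assoc[OF u D(2) p(4)] diff_prY[OF k] cmp_add[OF u arr_cmp[OF p(2) f(2)] arr_cmp[OF p(3) d(2)]]
      assoc[OF u p(2) f(2), symmetric] assoc[OF u p(3) d(2), symmetric] a_def b_def ..
  then have "(b \<Zcomp> F (Suc k)) \<oplus>[T,ob Y (Suc k)] (a \<Zcomp> diff Y k) = \<zero>[T,ob Y (Suc k)]"
    unfolding z using zero_cmp[OF p(4) T] by simp
  then have eq: "(\<ominus>[T,ob X (Suc k)] b) \<Zcomp> F (Suc k) = a \<Zcomp> diff Y k"
    using neg_add_eq_zero_iff[OF arr_neg[OF bF] ad] neg_neg[OF bF] neg_cmp[OF b f(2)] by simp
  have "(\<ominus>[T,ob X (Suc k)] b) \<Zcomp> diff X (Suc k) = \<zero>[T,ob X (Suc (Suc k))]" if k': "Suc k < n"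
  proof -
    have p': "arr (prX (Suc (Suc k))) (ob C (Suc (Suc k))) (ob X (Suc (Suc k)))"
      and d': "arr (diff X (Suc k)) (ob X (Suc k)) (ob X (Suc (Suc k)))"
      using k' arr_prX dX by auto
    have "(\<ominus>[T,ob X (Suc k)] b) \<Zcomp> diff X (Suc k) = (u \<Zcomp> diff C (Suc k)) \<Zcomp> prX (Suc (Suc k))"
      unfolding b_def neg_cmp[OF b[unfolded b_def] d'] assoc[OF u D(2) p'] diff_prX[OF k'] cmp_neg[OF u arr_cmp[OF p(2) d']]
        assoc[OF u p(2) d', symmetric] ..
    then show ?thesis
      unfolding z using zero_cmp[OF p' T] by simp
  qed
  then obtain c where c: "arr c T (ob X k)" "c \<Zcomp> F k = a" "c \<Zcomp> diff X k = \<ominus>[T,ob X (Suc k)] b"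
    using lift[OF k a arr_neg[OF b] eq] by blast
  obtain v where v: "arr v T (ob C k)" "v \<Zcomp> prX k = c"
    and v0: "0 < k \<Longrightarrow> v \<Zcomp> prY (k - 1) = \<zero>[T,ob Y (k - 1)]"
    using ex_pair_zero[OF _ c(1)] k by auto
  have "v \<Zcomp> diff C k = u"
  proof (rule cone_ext[of "Suc k"])
    show "arr (v \<Zcomp> diff C k) T (ob C (Suc k))" using v(1) D(1) by (rule arr_cmp)
    show "v \<Zcomp> diff C k \<Zcomp> prX (Suc k) = u \<Zcomp> prX (Suc k)"
      unfolding assoc[OF v(1) D(1) p(2)] diff_prX[OF k] cmp_neg[OF v(1) arr_cmp[OF p(1) d(1)]]
        assoc[OF v(1) p(1) d(1), symmetric] v(2) c(3) neg_neg[OF b] by (rule b_def)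
    have "v \<Zcomp> (diff C k \<Zcomp> prY k) = v \<Zcomp> (prX k \<Zcomp> F k)"
    proof (cases k)
      case 0
      then show ?thesis using f(1) by (simp add: diff_prY_0 prX_def ident_cmp)
    next
      case (Suc j)
      have h: "arr (prY j) (ob C k) (ob Y j)" "arr (diff Y j) (ob Y j) (ob Y k)"
        using k Suc arr_prY dY by auto
      have "v \<Zcomp> (prY j \<Zcomp> diff Y j) = \<zero>[T,ob Y k]"
        using assoc[OF v(1) h] v0 Suc zero_cmp[OF h(2) T] by simp
      then show ?thesis
        using diff_prY[of j] Suc k cmp_add[OF v(1) arr_cmp[OF p(1) f(1)] arr_cmp[OF h]]
          add_zero[OF arr_cmp[OF v(1) arr_cmp[OF p(1) f(1)]]] by simp
    qed
    then show "v \<Zcomp> diff C k \<Zcomp> prY (Suc k - 1) = u \<Zcomp> prY (Suc k - 1)"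
      using assoc[OF v(1) D(1) p(3)] assoc[OF v(1) p(1) f(1)] v(2) c(2) by (simp add: a_def)
  qed (use k u in simp_all)
  then show "\<exists>c. arr c T (ob C k) \<and> c \<Zcomp> diff C k = u"
    using v(1) by blast
qed

end

lemma (in additive_category) stepwise_pushout_imp_n_pushout:
  assumes "0 < n" "is_stepwise_pushout n X Y F"
  shows "is_n_pushout M n X Y F"
proof -
  interpret cone_of_chain_map M n X Y F
    using assms by unfold_locales (auto simp: is_stepwise_pushout_def)
  show ?thesis
    using chain_map stepwise_pushout_cone[OF assms(2)] by (simp add: is_n_pushout_def)
qed

lemma is_complex_rev_rev: "is_complex M N (rev_chain N (rev_chain N X)) \<longleftrightarrow> is_complex M N X"
  using is_complex_opposite[of "opposite M" N X] is_complex_opposite[of M N "rev_chain N X"] by simp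

lemma is_chain_map_rev_rev:
  "is_chain_map M N Y (rev_chain N (rev_chain N X)) F \<longleftrightarrow> is_chain_map M N Y X F"
  by (auto simp: is_chain_map_def is_complex_rev_rev)

text \<open>
  The mapping cone formed in the opposite category differs from the reversed one in its signs and in
  its choice of direct sums.  Only the condition on \<open>X\<close>, \<open>Y\<close> and \<open>F\<close> is therefore dualized, and the
  cone is treated by the separate criterion for \<open>n\<close>-kernels.
\<close>

lemma (in additive_category) stepwise_pushout_opposite_imp_n_pullback:
  assumes "0 < n" "preadditive_category.is_stepwise_pushout (opposite M) n (rev_chain n X) Y F"
  shows "is_n_pullback M n X (rev_chain n Y) (\<lambda>k. F (n - k))"
proof -
  interpret O: additive_category "opposite M" by (rule additive_category_opposite)
  have cm: "is_chain_map M n (rev_chain n Y) X (\<lambda>k. F (n - k))"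
    using assms(2) by (simp add: O.is_stepwise_pushout_def is_chain_map_opposite is_chain_map_rev_rev)
  interpret cone_of_chain_map M n "rev_chain n Y" X "\<lambda>k. F (n - k)"
    using assms(1) cm by unfold_locales
  have "is_n_kernel M n C"
  proof (rule stepwise_pullback_cone)
    fix T c
    assume "arr c T (ob (rev_chain n Y) 0)" "c \<Zcomp> F (n - 0) = \<zero>[T,ob X 0]"
      "c \<Zcomp> diff (rev_chain n Y) 0 = \<zero>[T,ob (rev_chain n Y) (Suc 0)]"
    then show "c = \<zero>[T,ob (rev_chain n Y) 0]"
      using assms(2) unfolding O.is_stepwise_pushout_def by (simp add: arr_opposite)
  next
    fix k T a b
    assume k: "k < n" and *: "arr a T (ob X k)" "arr b T (ob (rev_chain n Y) (Suc k))"
      "b \<Zcomp> F (n - Suc k) = a \<Zcomp> diff X k"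
      and z: "Suc k < n \<Longrightarrow> b \<Zcomp> diff (rev_chain n Y) (Suc k) = \<zero>[T,ob (rev_chain n Y) (Suc (Suc k))]"
    define j where "j = n - Suc k"
    have j: "j < n" "n - Suc j = k" "Suc j = n - k" "0 < j \<Longrightarrow> Suc k < n" "n - Suc (Suc k) = j - 1"
      using k by (auto simp: j_def)
    have "\<exists>c. O.arr c (ob Y (Suc j)) T \<and> F (Suc j) \<Zcomp>\<^bsub>opposite M\<^esub> c = a \<and> diff Y j \<Zcomp>\<^bsub>opposite M\<^esub> c = b"
    proof -
      have "O.arr a (ob (rev_chain n X) (Suc j)) T" "O.arr b (ob Y j) T"
        "F j \<Zcomp>\<^bsub>opposite M\<^esub> b = diff (rev_chain n X) j \<Zcomp>\<^bsub>opposite M\<^esub> a"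
        "0 < j \<longrightarrow> diff Y (j - 1) \<Zcomp>\<^bsub>opposite M\<^esub> b = \<zero>\<^bsub>mor (opposite M) (ob Y (j - 1)) T\<^esub>"
        using * z j by (simp_all add: arr_opposite j_def[symmetric])
      then show ?thesis
        using assms(2) j(1) unfolding O.is_stepwise_pushout_def by blast
    qed
    then show "\<exists>c. arr c T (ob (rev_chain n Y) k) \<and> c \<Zcomp> F (n - k) = a \<and> c \<Zcomp> diff (rev_chain n Y) k = b"
      using j(3) by (simp add: arr_opposite j_def[symmetric])
  qed
  then show ?thesis
    using cm by (simp add: is_n_pullback_def)
qed


section \<open>Construction of \<open>n\<close>-pushouts\<close>

text \<open>
  The data of the construction: an \<open>n\<close>-cokernel \<open>Z\<close> of the morphism \<open>(d, -f) : X\<^sup>0 \<rightarrow> X\<^sup>1 \<oplus> B\<close>, with this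
  morphism as its first differential, and a chain map \<open>w : Z \<rightarrow> X\<close> that is the projection in
  degree \<open>1\<close>.
\<close>

locale pushout_construction = additive_category M
  for M :: "('o, 'm, 'x) precat_scheme" (structure) +
  fixes n :: nat and X Z :: "('o, 'm) chain" and B :: 'o and f :: 'm and w :: "nat \<Rightarrow> 'm"
  assumes n_pos: "0 < n" and X: "is_complex M n X" and f: "arr f (ob X 0) B"
    and Z: "is_n_cokernel M n Z" "ob Z 0 = ob X 0" "ob Z 1 = bp_ob (dsum M (ob X 1) B)"
      "diff Z 0 = tuple (dsum M (ob X 1) B) (ob X 0) (diff X 0) (\<ominus>[ob X 0,B] f)"
    and w: "is_chain_map M n Z X w" "w 1 = bp_prl (dsum M (ob X 1) B)"
begin

abbreviation S where "S \<equiv> dsum M (ob X 1) B"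
abbreviation P where "P k \<equiv> dsum M (ob Z (Suc k)) (ob X k)"

definition F where
  "F k = (if k = 0 then f else if k = 1 then bp_inl S \<Zcomp> diff Z 1 else bp_inr (P k))"

text \<open>The inclusion \<open>Z\<^sup>k\<^sup>+\<^sup>1 \<rightarrow> Y\<^sup>k\<close> for \<open>k \<ge> 1\<close>; since \<open>Y\<^sup>1 = Z\<^sup>2\<close>, it is an identity for \<open>k = 1\<close>.\<close>

definition inZ where "inZ k = (if k = 1 then ident M (ob Z 2) else bp_inl (P k))"

text \<open>The restriction \<open>(-d, w) : Z\<^sup>k\<^sup>+\<^sup>1 \<rightarrow> Y\<^sup>k\<^sup>+\<^sup>1\<close> of the differential of \<open>Y\<close>, for \<open>k \<ge> 1\<close>.\<close>

definition restr where
  "restr k = tuple (P (Suc k)) (ob Z (Suc k)) (\<ominus>[ob Z (Suc k),ob Z (Suc (Suc k))] diff Z (Suc k)) (w (Suc k))"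

definition Y :: "('o, 'm) chain" where
  "Y = \<lparr>ob = (\<lambda>k. if k = 0 then B else if k = 1 then ob Z 2 else bp_ob (P k)),
    diff = (\<lambda>k. if k = 0 then bp_inr S \<Zcomp> diff Z 1 else if k = 1 then restr 1
      else cotuple (P k) (bp_ob (P (Suc k))) (restr k) (diff X k \<Zcomp> bp_inr (P (Suc k))))\<rparr>"

lemma ob_Y: "ob Y 0 = B" "ob Y (Suc 0) = ob Z 2" "1 < k \<Longrightarrow> ob Y k = bp_ob (P k)"
  by (simp_all add: Y_def)

lemmas dX = arr_diff_complex[OF X]
  and dZ = arr_diff_complex[OF n_cokernel_complex[OF Z(1)]]
  and arr_w = arr_chain_map[OF w(1)]
  and w_comm = chain_map_comm[OF w(1)]

lemma obX: "k \<le> n \<Longrightarrow> ob X k \<in> obj M"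
  using X by (simp add: is_complex_def is_sequence_def)

lemma obZ: "k \<le> n + 1 \<Longrightarrow> ob Z k \<in> obj M"
  using n_cokernel_complex[OF Z(1)] by (simp add: is_complex_def is_sequence_def)

lemma S_biproduct: "is_biproduct M (ob X (Suc 0)) B S"
  using dsum_biproduct[OF obX arrD(3)[OF f], of 1] n_pos by simp

lemma S_arr: "arr (bp_inl S) (ob X (Suc 0)) (ob Z (Suc 0))" "arr (bp_inr S) B (ob Z (Suc 0))"
    "arr (bp_prl S) (ob Z (Suc 0)) (ob X (Suc 0))"
  using biproduct_arr[OF S_biproduct obX arrD(3)[OF f]] Z(3) n_pos by simp_all

lemma P_biproduct: "k \<le> n \<Longrightarrow> is_biproduct M (ob Z (Suc k)) (ob X k) (P k)"
  by (intro dsum_biproduct obX obZ) auto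

lemma arr_inZ: "\<lbrakk>0 < k; k \<le> n\<rbrakk> \<Longrightarrow> arr (inZ k) (ob Z (Suc k)) (ob Y k)"
  using biproduct_arr[OF P_biproduct[of k] obZ obX] arr_ident[OF obZ[of 2]] n_pos
  by (auto simp: inZ_def Y_def numeral_2_eq_2)

lemma arr_F: "k \<le> n \<Longrightarrow> arr (F k) (ob X k) (ob Y k)"
  using biproduct_arr[OF P_biproduct[of k] obZ obX] arr_cmp[OF S_arr(1) dZ[of "Suc 0"]] f n_pos
  by (auto simp: F_def Y_def numeral_2_eq_2)

lemma arr_restr: "\<lbrakk>0 < k; k < n\<rbrakk> \<Longrightarrow> arr (restr k) (ob Z (Suc k)) (ob Y (Suc k))"
  using tuple(1)[OF P_biproduct[of "Suc k"] arr_neg[OF dZ[of "Suc k"]] arr_w[of "Suc k"]]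
  by (simp add: restr_def ob_Y)

lemma restr_cmp:
  assumes "0 < k" "k < n" and u: "arr u (ob Y (Suc k)) T"
  shows "restr k \<Zcomp> u = \<ominus>[ob Z (Suc k),T] (diff Z (Suc k) \<Zcomp> (inZ (Suc k) \<Zcomp> u))
    \<oplus>[ob Z (Suc k),T] (w (Suc k) \<Zcomp> (F (Suc k) \<Zcomp> u))"
proof -
  have d: "arr (diff Z (Suc k)) (ob Z (Suc k)) (ob Z (Suc (Suc k)))" using dZ assms by simp
  have "arr (inZ (Suc k) \<Zcomp> u) (ob Z (Suc (Suc k))) T" using arr_cmp[OF arr_inZ u] assms by simp
  then show ?thesis
    using tuple_cmp[OF P_biproduct[of "Suc k"] arr_neg[OF d] arr_w[of "Suc k"], of u T] u assms neg_cmp[OF d]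
    by (simp add: restr_def ob_Y inZ_def F_def)
qed

lemma restr_eq:
  assumes "0 < k" "k < n"
  shows "restr k = \<ominus>[ob Z (Suc k),ob Y (Suc k)] (diff Z (Suc k) \<Zcomp> inZ (Suc k))
    \<oplus>[ob Z (Suc k),ob Y (Suc k)] (w (Suc k) \<Zcomp> F (Suc k))"
  using restr_cmp[OF assms arr_ident] cmp_ident[OF arr_restr[OF assms]] cmp_ident[OF arr_inZ[of "Suc k"]]
    cmp_ident[OF arr_F[of "Suc k"]] arr_F[of "Suc k"] assms by (simp add: arrD)

lemma arr_diff_Y: "k < n \<Longrightarrow> arr (diff Y k) (ob Y k) (ob Y (Suc k))"
proof -
  assume k: "k < n"
  consider "k = 0" | "k = 1" | "1 < k" by linarith
  then show ?thesis
  proof cases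
    case 1
    then show ?thesis using arr_cmp[OF S_arr(2) dZ[of "Suc 0"]] n_pos by (simp add: Y_def numeral_2_eq_2)
  next
    case 2
    then show ?thesis using arr_restr[of 1] k by (simp add: Y_def numeral_2_eq_2)
  next
    case 3
    then have "arr (diff X k \<Zcomp> bp_inr (P (Suc k))) (ob X k) (ob Y (Suc k))"
      using arr_cmp[OF dX[OF k] arr_F[of "Suc k"]] k by (simp add: F_def)
    then show ?thesis
      using cotuple(1)[OF P_biproduct[of k] arr_restr[of k]] k 3 by (simp add: Y_def)
  qed
qed

lemma inZ_diff:
  assumes "0 < k" "k < n"
  shows "inZ k \<Zcomp> diff Y k = restr k"
proof (cases "k = 1")
  case True
  then show ?thesis using ident_cmp[OF arr_restr[of 1]] assms by (simp add: inZ_def Y_def numeral_2_eq_2)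
next
  case False
  have "arr (diff X k \<Zcomp> bp_inr (P (Suc k))) (ob X k) (ob Y (Suc k))"
    using arr_cmp[OF dX[of k] arr_F[of "Suc k"]] assms by (simp add: F_def)
  then show ?thesis
    using cotuple(2)[OF P_biproduct[of k] arr_restr[of k]] assms False by (simp add: inZ_def Y_def)
qed

text \<open>
  Of the components \<open>-d\<close> and \<open>w\<close> of \<open>restr k\<close>, the first one contributes \<open>d d = 0\<close>, and the second one
  is a chain map.  All relations between consecutive differentials of \<open>Y\<close> come from this one.
\<close>

lemma diff_restr:
  assumes "0 < k" "k < n"
  shows "diff Z k \<Zcomp> restr k = w k \<Zcomp> (diff X k \<Zcomp> F (Suc k))"
proof -
  have d: "arr (diff Z k) (ob Z k) (ob Z (Suc k))" "arr (diff Z (Suc k)) (ob Z (Suc k)) (ob Z (Suc (Suc k)))"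
    and i: "arr (inZ (Suc k)) (ob Z (Suc (Suc k))) (ob Y (Suc k))"
    and ww: "arr (w k) (ob Z k) (ob X k)" "arr (w (Suc k)) (ob Z (Suc k)) (ob X (Suc k))"
    and fs: "arr (F (Suc k)) (ob X (Suc k)) (ob Y (Suc k))" and x: "arr (diff X k) (ob X k) (ob X (Suc k))"
    using dZ arr_inZ arr_w arr_F dX assms by auto
  have "diff Z k \<Zcomp> (diff Z (Suc k) \<Zcomp> inZ (Suc k)) = \<zero>[ob Z k,ob Y (Suc k)]"
    using assoc[OF d i] complex_cmp[OF n_cokernel_complex[OF Z(1)], of k] zero_cmp[OF i arrD(2)[OF d(1)]] assms
    by simp
  then have "diff Z k \<Zcomp> restr k = diff Z k \<Zcomp> (w (Suc k) \<Zcomp> F (Suc k))"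
    unfolding restr_eq[OF assms] cmp_add[OF d(1) arr_neg[OF arr_cmp[OF d(2) i]] arr_cmp[OF ww(2) fs]]
      cmp_neg[OF d(1) arr_cmp[OF d(2) i]]
    using arr_cmp[OF d(1) arr_cmp[OF ww(2) fs]] by (simp add: neg_zero zero_add arrD)
  then show ?thesis
    using assoc[OF d(1) ww(2) fs] assoc[OF ww(1) x fs] w_comm[of k] assms by simp
qed

lemma F_1: "F (Suc 0) = bp_inl S \<Zcomp> diff Z (Suc 0)"
  by (simp add: F_def)

lemma F_diff: "k < n \<Longrightarrow> F k \<Zcomp> diff Y k = diff X k \<Zcomp> F (Suc k)"
proof -
  assume k: "k < n"
  consider "k = 0" | "k = 1" | "1 < k" by linarith
  then show ?thesis
  proof cases
    case 1
    have e: "arr (diff Z (Suc 0)) (ob Z (Suc 0)) (ob Z (Suc (Suc 0)))"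
      and d: "arr (diff X 0) (ob X 0) (ob X (Suc 0))" using dZ[of 1] dX n_pos by auto
    note ie = arr_cmp[OF S_arr(1) e] arr_cmp[OF S_arr(2) e]
    have "diff Z 0 \<Zcomp> diff Z (Suc 0) = \<zero>[ob X 0,ob Z (Suc (Suc 0))]"
      using complex_cmp[OF n_cokernel_complex[OF Z(1)], of 0] n_pos Z(2) by simp
    moreover have "diff Z 0 \<Zcomp> diff Z (Suc 0) = \<ominus>[ob X 0,ob Z (Suc (Suc 0))] (f \<Zcomp> (bp_inr S \<Zcomp> diff Z (Suc 0)))
        \<oplus>[ob X 0,ob Z (Suc (Suc 0))] (diff X 0 \<Zcomp> (bp_inl S \<Zcomp> diff Z (Suc 0)))"
      using tuple_cmp[OF S_biproduct d arr_neg[OF f], of "diff Z (Suc 0)"] e Z(3,4) neg_cmp[OF f ie(2)]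
        add_comm[OF arr_cmp[OF d ie(1)] arr_neg[OF arr_cmp[OF f ie(2)]]] by simp
    ultimately have "diff X 0 \<Zcomp> (bp_inl S \<Zcomp> diff Z (Suc 0)) = f \<Zcomp> (bp_inr S \<Zcomp> diff Z (Suc 0))"
      using neg_add_eq_zero_iff[OF arr_cmp[OF f ie(2)] arr_cmp[OF d ie(1)]] by simp
    then show ?thesis using 1 by (simp add: F_def Y_def)
  next
    case 2
    have e: "arr (diff Z (Suc 0)) (ob Z (Suc 0)) (ob Z (Suc (Suc 0)))"
      and d: "arr (diff X (Suc 0)) (ob X (Suc 0)) (ob X (Suc (Suc 0)))"
      and r: "arr (restr (Suc 0)) (ob Z (Suc (Suc 0))) (ob Y (Suc (Suc 0)))"
      and g: "arr (F (Suc (Suc 0))) (ob X (Suc (Suc 0))) (ob Y (Suc (Suc 0)))"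
      using dZ dX arr_restr arr_F k 2 by auto
    show ?thesis
      using assoc[OF S_arr(1) e r] diff_restr[of 1] assoc[OF S_arr(1,3) arr_cmp[OF d g]] biproduct_eq(1)[OF S_biproduct]
        w(2) ident_cmp[OF arr_cmp[OF d g]] 2 k by (simp add: F_1 Y_def)
  next
    case 3
    then have "arr (diff X k \<Zcomp> bp_inr (P (Suc k))) (ob X k) (ob Y (Suc k))"
      using arr_cmp[OF dX[OF k] arr_F[of "Suc k"]] k by (simp add: F_def)
    then show ?thesis
      using cotuple(3)[OF P_biproduct[of k] arr_restr[of k]] k 3 by (simp add: F_def Y_def)
  qed
qed

lemma Y_coext:
  assumes "0 < k" "k \<le> n" "arr u (ob Y k) T" "arr v (ob Y k) T"
    and "inZ k \<Zcomp> u = inZ k \<Zcomp> v" "F k \<Zcomp> u = F k \<Zcomp> v"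
  shows "u = v"
proof (cases "k = 1")
  case True
  then show ?thesis using assms by (simp add: inZ_def ob_Y ident_cmp)
next
  case False
  then show ?thesis
    using biproduct_coext[OF P_biproduct[of k] obZ obX, of u T v] assms by (simp add: inZ_def F_def ob_Y)
qed

text \<open>
  On the summand \<open>Z\<^sup>k\<^sup>+\<^sup>1\<close> the two contributions to the component in \<open>X\<^sup>k\<^sup>+\<^sup>2\<close> are \<open>-d w\<close> and \<open>w d\<close>, which
  cancel.
\<close>

lemma diff_Y_diff_Y:
  assumes "Suc k < n"
  shows "diff Y k \<Zcomp> diff Y (Suc k) = \<zero>[ob Y k,ob Y (Suc (Suc k))]"
proof (cases "k = 0")
  case True
  have r: "arr (restr 1) (ob Z (Suc (Suc 0))) (ob Y (Suc (Suc 0)))"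
    and e: "arr (diff Z 1) (ob Z (Suc 0)) (ob Z (Suc (Suc 0)))"
    and d: "arr (diff X 1 \<Zcomp> F (Suc (Suc 0))) (ob X (Suc 0)) (ob Y (Suc (Suc 0)))"
    using arr_restr[of 1] dZ[of 1] arr_cmp[OF dX[of "Suc 0"] arr_F[of "Suc (Suc 0)"]] assms True by (simp_all add: numeral_2_eq_2)
  have "bp_inr S \<Zcomp> (diff Z 1 \<Zcomp> restr 1) = \<zero>[B,ob Y (Suc (Suc 0))]"
    using diff_restr[of 1] w(2) assoc[OF S_arr(2,3) d] biproduct_eq(4)[OF S_biproduct] zero_cmp[OF d arrD(3)[OF f]]
      assms True by simp
  then show ?thesis
    using assoc[OF S_arr(2) e r] True by (simp add: Y_def)
next
  case False
  have D: "arr (diff Y k) (ob Y k) (ob Y (Suc k))" "arr (diff Y (Suc k)) (ob Y (Suc k)) (ob Y (Suc (Suc k)))"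
    and i: "arr (inZ k) (ob Z (Suc k)) (ob Y k)"
    and d: "arr (diff X k) (ob X k) (ob X (Suc k))" "arr (diff X (Suc k)) (ob X (Suc k)) (ob X (Suc (Suc k)))"
    and g: "arr (F k) (ob X k) (ob Y k)" "arr (F (Suc k)) (ob X (Suc k)) (ob Y (Suc k))"
      "arr (F (Suc (Suc k))) (ob X (Suc (Suc k))) (ob Y (Suc (Suc k)))"
    and ww: "arr (w (Suc k)) (ob Z (Suc k)) (ob X (Suc k))"
    using arr_diff_Y arr_inZ dX arr_F arr_w assms False by auto
  have o: "ob Y (Suc (Suc k)) \<in> obj M" using D(2) by (rule arrD)
  show ?thesis
  proof (rule Y_coext[of k])
    show "arr (diff Y k \<Zcomp> diff Y (Suc k)) (ob Y k) (ob Y (Suc (Suc k)))"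
      using D by (rule arr_cmp)
    show "arr \<zero>[ob Y k,ob Y (Suc (Suc k))] (ob Y k) (ob Y (Suc (Suc k)))"
      using D by (simp add: arr_zero arrD)
    have "inZ k \<Zcomp> (diff Y k \<Zcomp> diff Y (Suc k)) = restr k \<Zcomp> diff Y (Suc k)"
      using assoc[OF i D] inZ_diff[of k] False assms by simp
    also have "\<dots> = \<ominus>[ob Z (Suc k),ob Y (Suc (Suc k))] (w (Suc k) \<Zcomp> (diff X (Suc k) \<Zcomp> F (Suc (Suc k))))
        \<oplus>[ob Z (Suc k),ob Y (Suc (Suc k))] (w (Suc k) \<Zcomp> (diff X (Suc k) \<Zcomp> F (Suc (Suc k))))"
      using restr_cmp[OF _ _ D(2)] inZ_diff[of "Suc k"] diff_restr[of "Suc k"] F_diff[of "Suc k"] False assms by simp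
    also have "\<dots> = \<zero>[ob Z (Suc k),ob Y (Suc (Suc k))]"
      by (rule neg_add_self[OF arr_cmp[OF ww arr_cmp[OF d(2) g(3)]]])
    finally show "inZ k \<Zcomp> (diff Y k \<Zcomp> diff Y (Suc k)) = inZ k \<Zcomp> \<zero>[ob Y k,ob Y (Suc (Suc k))]"
      using cmp_zero[OF i o] by simp
    have "F k \<Zcomp> (diff Y k \<Zcomp> diff Y (Suc k)) = diff X k \<Zcomp> diff X (Suc k) \<Zcomp> F (Suc (Suc k))"
      using assoc[OF g(1) D] F_diff[of k] assoc[OF d(1) g(2) D(2)] F_diff[of "Suc k"] assoc[OF d g(3)] assms by simp
    then show "F k \<Zcomp> (diff Y k \<Zcomp> diff Y (Suc k)) = F k \<Zcomp> \<zero>[ob Y k,ob Y (Suc (Suc k))]"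
      using complex_cmp[OF X assms] zero_cmp[OF g(3) arrD(2)[OF d(1)]] cmp_zero[OF g(1) o] by simp
  qed (use False assms in simp_all)
qed

lemma obY: "k \<le> n \<Longrightarrow> ob Y k \<in> obj M"
  using arr_F by (blast dest: arrD)

lemma chain_map_F: "is_chain_map M n X Y F"
  using X obY arr_diff_Y diff_Y_diff_Y arr_F F_diff
  by (auto simp: is_chain_map_def is_complex_def is_sequence_def arr_def)

text \<open>
  Given \<open>(a, b)\<close> on \<open>X\<^sup>k\<^sup>+\<^sup>1\<close> and \<open>Y\<^sup>k\<close>, the lift to \<open>Y\<^sup>k\<^sup>+\<^sup>1 = Z\<^sup>k\<^sup>+\<^sup>2 \<oplus> X\<^sup>k\<^sup>+\<^sup>1\<close> must have \<open>a\<close> as its second component.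
  Its first component \<open>\<beta>\<close> then has to satisfy \<open>d \<beta> = w a - b'\<close>, where \<open>b'\<close> is the restriction of
  \<open>b\<close> to \<open>Z\<^sup>k\<^sup>+\<^sup>1\<close>.  Such a \<open>\<beta>\<close> exists because \<open>Z\<close> is an \<open>n\<close>-cokernel and \<open>d b' = w d a = d w a\<close>.
\<close>

lemma stepwise_pushout_F: "is_stepwise_pushout n X Y F"
  unfolding is_stepwise_pushout_def
proof (intro conjI allI impI chain_map_F)
  fix T c
  assume c: "arr c (ob Y n) T" and Fc: "F n \<Zcomp> c = \<zero>[ob X n,T]" and dc: "diff Y (n - 1) \<Zcomp> c = \<zero>[ob Y (n - 1),T]"
  have T: "T \<in> obj M" using c by (rule arrD)
  have i: "arr (inZ n) (ob Z (Suc n)) (ob Y n)" and e: "arr (diff Z n) (ob Z n) (ob Z (Suc n))"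
    using arr_inZ dZ n_pos by auto
  have "diff Z n \<Zcomp> (inZ n \<Zcomp> c) = \<zero>[ob Z n,T]"
  proof (cases "n = 1")
    case True
    have c': "arr c (ob Z (Suc n)) T" "inZ n \<Zcomp> c = c" using c True by (simp_all add: ob_Y inZ_def ident_cmp numeral_2_eq_2)
    have e': "arr (diff Z n) (ob Z (Suc 0)) (ob Z (Suc n))" using e True by simp
    \<comment> \<open>The two assumptions on \<open>c\<close> are the two coordinates of this equation.\<close>
    have "diff Z n \<Zcomp> c = \<zero>[ob Z (Suc 0),T]"
    proof (rule biproduct_coext[OF S_biproduct obX arrD(3)[OF f]])
      show "arr (diff Z n \<Zcomp> c) (bp_ob S) T" "arr \<zero>[ob Z (Suc 0),T] (bp_ob S) T"
        using arr_cmp[OF e' c'(1)] arr_zero[OF obZ[of "Suc 0"] T] Z(3) by simp_all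
      show "bp_inl S \<Zcomp> (diff Z n \<Zcomp> c) = bp_inl S \<Zcomp> \<zero>[ob Z (Suc 0),T]"
        using assoc[OF S_arr(1) e' c'(1)] Fc True cmp_zero[OF S_arr(1) T] by (simp add: F_def)
      show "bp_inr S \<Zcomp> (diff Z n \<Zcomp> c) = bp_inr S \<Zcomp> \<zero>[ob Z (Suc 0),T]"
        using assoc[OF S_arr(2) e' c'(1)] dc True cmp_zero[OF S_arr(2) T] by (simp add: Y_def)
    qed (use n_pos in simp)
    then show ?thesis using c' True by simp
  next
    case False
    then obtain m where m: "n = Suc m" "0 < m" using n_pos by (cases n) auto
    have d: "arr (inZ m) (ob Z n) (ob Y m)" "arr (diff Y m) (ob Y m) (ob Y n)"
      and wn: "arr (w n) (ob Z n) (ob X n)"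
      using m arr_inZ[of m] arr_diff_Y arr_w by auto
    have "\<ominus>[ob Z n,T] (diff Z n \<Zcomp> (inZ n \<Zcomp> c)) = restr m \<Zcomp> c"
      using restr_cmp[of m c T] m c Fc cmp_zero[OF wn T] add_zero[OF arr_neg[OF arr_cmp[OF e arr_cmp[OF i c]]]] by simp
    also have "\<dots> = \<zero>[ob Z n,T]"
      using assoc[OF d c] inZ_diff[of m] dc m cmp_zero[OF d(1) T] by simp
    finally show ?thesis
      using neg_neg[OF arr_cmp[OF e arr_cmp[OF i c]]] neg_zero[OF arrD(2)[OF e] T] by simp
  qed
  then have "inZ n \<Zcomp> c = \<zero>[ob Z (Suc n),T]"
    by (rule n_cokernel_cancel_last[OF Z(1) arr_cmp[OF i c]])
  then show "c = \<zero>[ob Y n,T]"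
    using Y_coext[OF n_pos _ c arr_zero[OF arrD(2)[OF c] T]] cmp_zero[OF i T] Fc cmp_zero[OF arr_F T, of n] by simp
next
  fix k T a b
  assume k: "k < n" and a: "arr a (ob X (Suc k)) T" and b: "arr b (ob Y k) T"
    and ab: "F k \<Zcomp> b = diff X k \<Zcomp> a" and db: "0 < k \<longrightarrow> diff Y (k - 1) \<Zcomp> b = \<zero>[ob Y (k - 1),T]"
  have T: "T \<in> obj M" using a by (rule arrD)
  have d: "arr (diff X k) (ob X k) (ob X (Suc k))" using dX k by simp
  show "\<exists>c. arr c (ob Y (Suc k)) T \<and> F (Suc k) \<Zcomp> c = a \<and> diff Y k \<Zcomp> c = b"
  proof (cases "k = 0")
    case True
    have a0: "arr a (ob X (Suc 0)) T" and b0: "arr b B T" and d0: "arr (diff X 0) (ob X 0) (ob X (Suc 0))"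
      using a b d True by (simp_all add: ob_Y)
    have u: "arr (cotuple S T a b) (ob Z (Suc 0)) T" "bp_inl S \<Zcomp> cotuple S T a b = a"
      "bp_inr S \<Zcomp> cotuple S T a b = b"
      using cotuple[OF S_biproduct a0 b0] Z(3) by simp_all
    have "diff Z 0 \<Zcomp> cotuple S T a b = (diff X 0 \<Zcomp> a) \<oplus>[ob X 0,T] (\<ominus>[ob X 0,T] (f \<Zcomp> b))"
      using tuple_cmp[OF S_biproduct d0 arr_neg[OF f], of "cotuple S T a b" T] u Z(3,4) neg_cmp[OF f b0] by simp
    also have "\<dots> = \<zero>[ob Z 0,T]"
      using ab True add_comm[OF arr_cmp[OF f b0] arr_neg[OF arr_cmp[OF f b0]]] neg_add_self[OF arr_cmp[OF f b0]] Z(2)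
      by (simp add: F_def)
    finally obtain c where c: "arr c (ob Z (Suc (Suc 0))) T" "diff Z (Suc 0) \<Zcomp> c = cotuple S T a b"
      using n_cokernel_factor[OF Z(1) n_pos u(1)] by blast
    have e: "arr (diff Z (Suc 0)) (ob Z (Suc 0)) (ob Z (Suc (Suc 0)))" using dZ[of 1] n_pos by simp
    have "F (Suc 0) \<Zcomp> c = a" "diff Y 0 \<Zcomp> c = b"
      using assoc[OF S_arr(1) e c(1)] assoc[OF S_arr(2) e c(1)] c(2) u by (simp_all add: F_def Y_def)
    then show ?thesis using c(1) True by (auto simp: ob_Y numeral_2_eq_2)
  next
    case False
    then have k0: "0 < k" by simp
    have i: "arr (inZ k) (ob Z (Suc k)) (ob Y k)" and e: "arr (diff Z k) (ob Z k) (ob Z (Suc k))"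
      and ww: "arr (w k) (ob Z k) (ob X k)" "arr (w (Suc k)) (ob Z (Suc k)) (ob X (Suc k))"
      and g: "arr (F k) (ob X k) (ob Y k)"
      using arr_inZ dZ arr_w arr_F k k0 by auto
    have ib: "arr (inZ k \<Zcomp> b) (ob Z (Suc k)) T" and wa: "arr (w (Suc k) \<Zcomp> a) (ob Z (Suc k)) T"
      using arr_cmp i b ww a by blast+
    \<comment> \<open>For \<open>k = 1\<close> this is checked on the two summands of \<open>Z\<^sup>1 = X\<^sup>1 \<oplus> B\<close>; for \<open>k > 1\<close> it is the
      vanishing of \<open>b\<close> after the differential of \<open>Y\<close>, restricted to \<open>Z\<^sup>k\<close>.\<close>
    have key: "diff Z k \<Zcomp> (inZ k \<Zcomp> b) = w k \<Zcomp> (diff X k \<Zcomp> a)"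
    proof (cases "k = 1")
      case True
      have e1: "arr (diff Z 1) (ob Z (Suc 0)) (ob Z (Suc (Suc 0)))" and b1: "arr b (ob Z (Suc (Suc 0))) T"
        and da: "arr (diff X 1 \<Zcomp> a) (ob X (Suc 0)) T"
        using e b True arr_cmp[OF d a] by (simp_all add: ob_Y numeral_2_eq_2)
      have "diff Z 1 \<Zcomp> b = bp_prl S \<Zcomp> (diff X 1 \<Zcomp> a)"
      proof (rule biproduct_coext[OF S_biproduct obX arrD(3)[OF f]])
        show "arr (diff Z 1 \<Zcomp> b) (bp_ob S) T" "arr (bp_prl S \<Zcomp> (diff X 1 \<Zcomp> a)) (bp_ob S) T"
          using arr_cmp[OF e1 b1] arr_cmp[OF S_arr(3) da] Z(3) by simp_all
        show "bp_inl S \<Zcomp> (diff Z 1 \<Zcomp> b) = bp_inl S \<Zcomp> (bp_prl S \<Zcomp> (diff X 1 \<Zcomp> a))"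
          using assoc[OF S_arr(1) e1 b1] ab True assoc[OF S_arr(1,3) da] biproduct_eq(1)[OF S_biproduct] ident_cmp[OF da]
          by (simp add: F_def)
        show "bp_inr S \<Zcomp> (diff Z 1 \<Zcomp> b) = bp_inr S \<Zcomp> (bp_prl S \<Zcomp> (diff X 1 \<Zcomp> a))"
          using assoc[OF S_arr(2) e1 b1] db True assoc[OF S_arr(2,3) da] biproduct_eq(4)[OF S_biproduct]
            zero_cmp[OF da arrD(3)[OF f]] by (simp add: Y_def)
      qed (use n_pos in simp)
      then show ?thesis using True w(2) ident_cmp[OF b1] by (simp add: inZ_def numeral_2_eq_2)
    next
      case False
      then obtain m where m: "k = Suc m" "0 < m" using k0 by (cases k) auto
      have h: "arr (inZ m) (ob Z k) (ob Y m)" "arr (diff Y m) (ob Y m) (ob Y k)"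
        using m k arr_inZ[of m] arr_diff_Y by auto
      have "\<ominus>[ob Z k,T] (diff Z k \<Zcomp> (inZ k \<Zcomp> b)) \<oplus>[ob Z k,T] (w k \<Zcomp> (F k \<Zcomp> b)) = restr m \<Zcomp> b"
        using restr_cmp[of m b T] m k b by simp
      also have "\<dots> = \<zero>[ob Z k,T]"
        using assoc[OF h b] inZ_diff[of m] db m k cmp_zero[OF h(1) T] by simp
      finally show ?thesis
        using neg_add_eq_zero_iff[OF arr_cmp[OF e ib] arr_cmp[OF ww(1) arr_cmp[OF g b]]] ab by simp
    qed
    define r where "r = (w (Suc k) \<Zcomp> a) \<oplus>[ob Z (Suc k),T] (\<ominus>[ob Z (Suc k),T] (inZ k \<Zcomp> b))"
    have r: "arr r (ob Z (Suc k)) T"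
      unfolding r_def using arr_add arr_neg ib wa by blast
    have "diff Z k \<Zcomp> (w (Suc k) \<Zcomp> a) = diff Z k \<Zcomp> (inZ k \<Zcomp> b)"
      using assoc[OF e ww(2) a] assoc[OF ww(1) d a] w_comm[OF k] key by simp
    then have "diff Z k \<Zcomp> r = (diff Z k \<Zcomp> (inZ k \<Zcomp> b)) \<oplus>[ob Z k,T] (\<ominus>[ob Z k,T] (diff Z k \<Zcomp> (inZ k \<Zcomp> b)))"
      unfolding r_def cmp_add[OF e wa arr_neg[OF ib]] cmp_neg[OF e ib] by simp
    also have "\<dots> = \<zero>[ob Z k,T]"
      using add_comm[OF arr_cmp[OF e ib] arr_neg[OF arr_cmp[OF e ib]]] neg_add_self[OF arr_cmp[OF e ib]] by simp
    finally obtain \<beta> where \<beta>: "arr \<beta> (ob Z (Suc (Suc k))) T" "diff Z (Suc k) \<Zcomp> \<beta> = r"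
      using n_cokernel_factor[OF Z(1) k r] by blast
    define c where "c = cotuple (P (Suc k)) T \<beta> a"
    have c: "arr c (ob Y (Suc k)) T" "inZ (Suc k) \<Zcomp> c = \<beta>" "F (Suc k) \<Zcomp> c = a"
      using cotuple[OF P_biproduct[of "Suc k"] \<beta>(1) a] k k0 by (simp_all add: c_def ob_Y inZ_def F_def)
    have D: "arr (diff Y k) (ob Y k) (ob Y (Suc k))" and g': "arr (F (Suc k)) (ob X (Suc k)) (ob Y (Suc k))"
      using arr_diff_Y arr_F k by auto
    have "diff Y k \<Zcomp> c = b"
    proof (rule Y_coext[OF k0])
      show "arr (diff Y k \<Zcomp> c) (ob Y k) T" using D c(1) by (rule arr_cmp)
      have "inZ k \<Zcomp> (diff Y k \<Zcomp> c) = restr k \<Zcomp> c"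
        using assoc[OF i D c(1)] inZ_diff[OF k0 k] by simp
      also have "\<dots> = \<ominus>[ob Z (Suc k),T] r \<oplus>[ob Z (Suc k),T] (w (Suc k) \<Zcomp> a)"
        using restr_cmp[OF k0 k c(1)] c(2,3) \<beta>(2) by simp
      also have "\<dots> = inZ k \<Zcomp> b"
        unfolding r_def by (rule neg_add_cancel[OF wa ib])
      finally show "inZ k \<Zcomp> (diff Y k \<Zcomp> c) = inZ k \<Zcomp> b" .
      show "F k \<Zcomp> (diff Y k \<Zcomp> c) = F k \<Zcomp> b"
        using assoc[OF g D c(1)] F_diff[OF k] assoc[OF d g' c(1)] c(3) ab by simp
    qed (use k b in simp_all)
    then show ?thesis using c by blast
  qed
qed

end


section \<open>The \<open>n\<close>-exact structure of an \<open>n\<close>-abelian category\<close>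

lemma (in preadditive_category) is_mono_cmp:
  assumes f: "arr f A B" "is_mono M A B f" and g: "arr g B C" "is_mono M B C g"
  shows "is_mono M A C (f \<Zcomp> g)"
  unfolding mono_iff_cancel_zero[OF arr_cmp[OF f(1) g(1)]]
proof (intro allI impI)
  fix T u assume u: "arr u T A" "u \<Zcomp> (f \<Zcomp> g) = \<zero>[T,C]"
  then have "(u \<Zcomp> f) \<Zcomp> g = \<zero>[T,C]" using assoc[OF u(1) f(1) g(1)] by simp
  then have "u \<Zcomp> f = \<zero>[T,B]" by (rule mono_cancel_zero[OF g(2) arr_cmp[OF u(1) f(1)] g(1)])
  then show "u = \<zero>[T,A]" by (rule mono_cancel_zero[OF f(2) u(1) f(1)])
qed

lemma (in preadditive_category) n_exact_mono:
  assumes "is_n_exact M n X"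
  shows "arr (diff X 0) (ob X 0) (ob X 1)" "is_mono M (ob X 0) (ob X 1) (diff X 0)"
proof -
  have K: "is_n_kernel M n X" using assms by (simp add: is_n_exact_def)
  show d: "arr (diff X 0) (ob X 0) (ob X 1)"
    using arr_diff_complex[of "n + 1" X 0] assms by (simp add: is_n_exact_def)
  show "is_mono M (ob X 0) (ob X 1) (diff X 0)"
    unfolding mono_iff_cancel_zero[OF d] using K unfolding n_kernel_iff by simp
qed

lemma (in preadditive_category) zero_sequence_n_exact:
  assumes "is_zero_object M Z"
  shows "is_n_exact M n \<lparr>ob = (\<lambda>_. Z), diff = (\<lambda>_. \<zero>[Z,Z])\<rparr>" (is "is_n_exact M n ?Z")
proof -
  have Z: "Z \<in> obj M" using assms by (simp add: is_zero_object_def)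
  have into: "u = v" if "arr u T Z" "arr v T Z" for u v T
    using that assms by (auto simp: is_zero_object_def arr_def)
  have out: "u = v" if "arr u Z T" "arr v Z T" for u v T
    using that assms by (auto simp: is_zero_object_def arr_def)
  have zz: "arr \<zero>[Z,Z] Z Z" using Z by (simp add: arr_zero)
  have C: "is_complex M (n + 1) ?Z"
    using Z zz zero_cmp[OF zz Z] by (simp add: is_complex_def is_sequence_def arrD(1))
  have "is_n_kernel M n ?Z"
    unfolding n_kernel_iff
  proof (intro conjI allI impI C)
    fix T c assume "arr c T (ob ?Z 0)"
    then show "c = \<zero>[T,ob ?Z 0]"
      using into[of c T "\<zero>[T,Z]"] arr_zero[of T Z] by (simp add: arrD)
  next
    fix k T b assume "arr b T (ob ?Z (Suc k))"
    then show "\<exists>c. arr c T (ob ?Z k)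
        \<and> c \<Zcomp> diff ?Z k = b"
      using into[of "b \<Zcomp> \<zero>[Z,Z]" T b] arr_cmp[of b T Z, OF _ zz] by (intro exI[of _ b]) simp
  qed
  moreover have "is_n_cokernel M n ?Z"
    unfolding n_cokernel_iff
  proof (intro conjI allI impI C)
    fix T c assume "arr c (ob ?Z (Suc n)) T"
    then show "c = \<zero>[ob ?Z (Suc n),T]"
      using out[of c T "\<zero>[Z,T]"] arr_zero[of Z T] by (simp add: arrD)
  next
    fix k T b assume "arr b (ob ?Z (Suc k)) T"
    then show "\<exists>c. arr c (ob ?Z (Suc (Suc k))) T
        \<and> diff ?Z (Suc k) \<Zcomp> c = b"
      using out[of "\<zero>[Z,Z] \<Zcomp> b" T b] arr_cmp[OF zz, of b T] by (intro exI[of _ b]) simp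
  qed
  ultimately show ?thesis
    using C by (simp add: is_n_exact_def)
qed

context n_abelian_category
begin

text \<open>
  The whole construction, with the preservation of monomorphisms.  The latter needs A2 for the
  sequence \<open>Z\<close>: its first differential becomes a kernel of the second one.
\<close>

lemma ex_stepwise_pushout:
  assumes n: "0 < n" and X: "is_complex M n X" and f: "arr f (ob X 0) B"
  shows "\<exists>Y F. is_stepwise_pushout n X Y F \<and> ob Y 0 = B \<and> F 0 = f \<and>
    (is_mono M (ob X 0) (ob X 1) (diff X 0) \<longrightarrow> is_mono M (ob Y 0) (ob Y 1) (diff Y 0))"
proof -
  let ?S = "dsum M (ob X 1) B"
  let ?g = "tuple ?S (ob X 0) (diff X 0) (\<ominus>[ob X 0,B] f)"
  have d: "arr (diff X 0) (ob X 0) (ob X 1)" using arr_diff_complex[OF X n] by simp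
  have S: "is_biproduct M (ob X 1) B ?S" using d f by (intro dsum_biproduct) (auto dest: arrD)
  note s = biproduct_arr[OF S arrD(3)[OF d] arrD(3)[OF f]]
  note g = tuple[OF S d arr_neg[OF f]]
  obtain Z where hZ: "ob Z 0 = ob X 0" "ob Z 1 = bp_ob ?S" "diff Z 0 = ?g" "is_n_cokernel M n Z"
    using A1_cokernel[of "ob X 0" "bp_ob ?S" ?g] g(1) by (auto simp: arr_def)
  obtain w where w: "is_chain_map M n Z X w" "w 1 = bp_prl ?S"
    using chain_map_extension[OF hZ(4) X _ n, of "ident M (ob X 0)" "bp_prl ?S"] s(3) hZ arr_ident[OF arrD(2)[OF d]]
      g(2) ident_cmp[OF d] by auto
  interpret pushout_construction M n X Z B f w
    using n X f hZ w by unfold_locales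
  have e: "arr (diff Z 1) (bp_ob ?S) (ob Z 2)" using dZ[of 1] hZ(2) n by (simp add: numeral_2_eq_2)
  have Y: "ob Y 0 = B" "ob Y 1 = ob Z 2" "diff Y 0 = bp_inr ?S \<Zcomp> diff Z 1" "F 0 = f"
    by (simp_all add: Y_def F_def)
  have "is_mono M B (ob Z 2) (bp_inr ?S \<Zcomp> diff Z 1)" if m: "is_mono M (ob X 0) (ob X 1) (diff X 0)"
    unfolding mono_iff_cancel_zero[OF arr_cmp[OF s(2) e]]
  proof (intro allI impI)
    \<comment> \<open>Its first component is the monomorphism \<open>X\<^sup>0 \<rightarrow> X\<^sup>1\<close>.\<close>
    have "is_mono M (ob Z 0) (ob Z 1) (diff Z 0)"
      unfolding hZ mono_iff_cancel_zero[OF g(1)]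
    proof (intro allI impI)
      fix T u assume u: "arr u T (ob X 0)" "u \<Zcomp> ?g = \<zero>[T,bp_ob ?S]"
      then have "u \<Zcomp> diff X 0 = \<zero>[T,ob X 1]"
        using assoc[OF u(1) g(1) s(3)] g(2) zero_cmp[OF s(3) arrD(2)[OF u(1)]] by simp
      then show "u = \<zero>[T,ob X 0]" by (rule mono_cancel_zero[OF m u(1) d])
    qed
    then have ex: "is_n_kernel M n Z" using A2 hZ(4) by (simp add: is_n_exact_def)
    fix T u assume u: "arr u T B" "u \<Zcomp> (bp_inr ?S \<Zcomp> diff Z 1) = \<zero>[T,ob Z 2]"
    have ui: "arr (u \<Zcomp> bp_inr ?S) T (ob Z 1)" using arr_cmp[OF u(1) s(2)] hZ(2) by simp
    have "(u \<Zcomp> bp_inr ?S) \<Zcomp> diff Z 1 = \<zero>[T,ob Z 2]" using assoc[OF u(1) s(2) e] u(2) by simp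
    then obtain v where v: "arr v T (ob X 0)" "v \<Zcomp> ?g = u \<Zcomp> bp_inr ?S"
      using n_kernel_factor[OF ex n, of "u \<Zcomp> bp_inr ?S" T] ui hZ by (auto simp: numeral_2_eq_2)
    have T: "T \<in> obj M" using u(1) by (rule arrD)
    have "v \<Zcomp> diff X 0 = (v \<Zcomp> ?g) \<Zcomp> bp_prl ?S" using assoc[OF v(1) g(1) s(3)] g(2) by simp
    also have "\<dots> = \<zero>[T,ob X 1]"
      unfolding v(2) using assoc[OF u(1) s(2,3)] biproduct_eq(4)[OF S] cmp_zero[OF u(1) arrD(3)[OF d]] by simp
    finally have "v = \<zero>[T,ob X 0]" by (rule mono_cancel_zero[OF m v(1) d])
    then have "u \<Zcomp> bp_inr ?S = \<zero>[T,bp_ob ?S]" using v(2) zero_cmp[OF g(1) T] by simp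
    then show "u = \<zero>[T,B]"
      using assoc[OF u(1) s(2,4)] biproduct_eq(2)[OF S] cmp_ident[OF u(1)] zero_cmp[OF s(4) T] by simp
  qed
  then show ?thesis
    using stepwise_pushout_F Y by metis
qed

lemma adm_mono_iff: "adm_mono {X. is_n_exact M n X} A B f \<longleftrightarrow> arr f A B \<and> is_mono M A B f"
proof
  assume "adm_mono {X. is_n_exact M n X} A B f"
  then show "arr f A B \<and> is_mono M A B f"
    using n_exact_mono unfolding adm_mono_def by auto
next
  assume *: "arr f A B \<and> is_mono M A B f"
  then obtain X where X: "ob X 0 = A" "ob X 1 = B" "diff X 0 = f" "is_n_cokernel M n X"
    using A1_cokernel[of A B f] by (auto simp: arr_def)
  then have "is_n_exact M n X" using A2 * by simp
  with X show "adm_mono {X. is_n_exact M n X} A B f" unfolding adm_mono_def by blast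
qed

end

lemma adm_epi_iff_adm_mono_opposite:
  "adm_epi n {X. is_n_exact M n X} A B f \<longleftrightarrow> adm_mono {X. is_n_exact (opposite M) n X} B A f"
proof
  assume "adm_epi n {X. is_n_exact M n X} A B f"
  then obtain X where "is_n_exact M n X" "ob X n = A" "ob X (n + 1) = B" "diff X n = f"
    by (auto simp: adm_epi_def)
  then show "adm_mono {X. is_n_exact (opposite M) n X} B A f"
    using is_n_exact_opposite[of "opposite M" n X]
    by (auto simp: adm_mono_def intro!: exI[of _ "rev_chain (n + 1) X"])
next
  assume "adm_mono {X. is_n_exact (opposite M) n X} B A f"
  then obtain X where "is_n_exact (opposite M) n X" "ob X 0 = B" "ob X 1 = A" "diff X 0 = f"
    by (auto simp: adm_mono_def)
  then show "adm_epi n {X. is_n_exact M n X} A B f"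
    by (auto simp: adm_epi_def is_n_exact_opposite intro!: exI[of _ "rev_chain (n + 1) X"])
qed

context n_abelian_category
begin

lemma adm_mono_closed:
  assumes "adm_mono {X. is_n_exact M n X} A B f" "adm_mono {X. is_n_exact M n X} B C g"
  shows "adm_mono {X. is_n_exact M n X} A C (f \<Zcomp> g)"
  using assms unfolding adm_mono_iff by (blast intro: arr_cmp is_mono_cmp)

lemma adm_epi_closed:
  assumes "adm_epi n {X. is_n_exact M n X} A B f" "adm_epi n {X. is_n_exact M n X} B C g"
  shows "adm_epi n {X. is_n_exact M n X} A C (f \<Zcomp> g)"
  using assms n_abelian_category.adm_mono_closed[OF n_abelian_category_opposite, of C B g A f]
  by (simp add: adm_epi_iff_adm_mono_opposite)

lemma ex_n_pushout:
  assumes n: "0 < n" and X: "is_n_exact M n X" and f: "B \<in> obj M" "f \<in> Hom M (ob X 0) B"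
  shows "\<exists>Y F. is_n_pushout M n X Y F \<and> ob Y 0 = B \<and> F 0 = f \<and>
    adm_mono {X. is_n_exact M n X} (ob Y 0) (ob Y 1) (diff Y 0)"
proof -
  have "is_complex M n X"
    using X is_complex_truncate[of M "n + 1" X n] by (simp add: is_n_exact_def)
  moreover have "arr f (ob X 0) B"
    using f n_exact_mono(1)[OF X] by (simp add: arr_def)
  ultimately obtain Y F where Y: "is_stepwise_pushout n X Y F" "ob Y 0 = B" "F 0 = f"
      "is_mono M (ob Y 0) (ob Y 1) (diff Y 0)"
    using ex_stepwise_pushout[OF n] n_exact_mono(2)[OF X] by blast
  moreover have "arr (diff Y 0) (ob Y 0) (ob Y 1)"
    using arr_diff_complex[OF chain_map_complex(2)[OF stepwise_pushout_chain_map[OF Y(1)]] n] by simp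
  ultimately show ?thesis
    using stepwise_pushout_imp_n_pushout[OF n] unfolding adm_mono_iff by blast
qed

lemma ex_n_pullback:
  assumes n: "0 < n" and X: "is_n_exact M n X" and g: "B \<in> obj M" "g \<in> Hom M B (ob X (n + 1))"
  shows "\<exists>Y G. is_n_pullback M n (drop_first X) Y G \<and> ob Y n = B \<and> G n = g \<and>
    adm_epi n {X. is_n_exact M n X} (ob Y (n - 1)) (ob Y n) (diff Y (n - 1))"
proof -
  interpret O: n_abelian_category "opposite M" n by (rule n_abelian_category_opposite)
  \<comment> \<open>Up to degree \<open>n\<close> this is the reversal of the full sequence, so it starts with a monomorphism of
    the opposite category.\<close>
  let ?X = "rev_chain n (drop_first X)"
  have "is_complex M n (drop_first X)"
    using X by (simp add: is_n_exact_def is_complex_def is_sequence_def drop_first_def)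
  then have X': "is_complex (opposite M) n ?X"
    using is_complex_opposite[of "opposite M" n "drop_first X"] by simp
  have "is_n_exact (opposite M) n (rev_chain (n + 1) X)"
    using X is_n_exact_opposite[of "opposite M" n X] by simp
  then have m: "O.arr (diff ?X 0) (ob ?X 0) (ob ?X 1)" "is_mono (opposite M) (ob ?X 0) (ob ?X 1) (diff ?X 0)"
    using O.n_exact_mono[of n "rev_chain (n + 1) X"] n by (simp_all add: drop_first_def)
  have "O.arr g (ob ?X 0) B"
    using m(1) g by (simp add: O.arr_def drop_first_def)
  then obtain Y F where Y: "O.is_stepwise_pushout n ?X Y F" "ob Y 0 = B" "F 0 = g"
      "is_mono (opposite M) (ob Y 0) (ob Y 1) (diff Y 0)"
    using O.ex_stepwise_pushout[OF n X'] m(2) by blast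
  moreover have "O.arr (diff Y 0) (ob Y 0) (ob Y 1)"
    using O.arr_diff_complex[OF O.chain_map_complex(2)[OF O.stepwise_pushout_chain_map[OF Y(1)]] n] by simp
  ultimately have "adm_epi n {X. is_n_exact M n X} (ob Y 1) (ob Y 0) (diff Y 0)"
    unfolding adm_epi_iff_adm_mono_opposite O.adm_mono_iff by blast
  then show ?thesis
    using stepwise_pushout_opposite_imp_n_pullback[OF n Y(1)] Y(2,3) n
    by (intro exI[of _ "rev_chain n Y"] exI[of _ "\<lambda>k. F (n - k)"]) simp
qed

end

theorem theorem4p4:
  fixes M :: "('o, 'm, 'x) precat_scheme" and n :: nat
  assumes "n > 0"
    and "n_abelian_category M n"
  shows "n_exact_category M n {X. is_n_exact M n X}"
proof -
  interpret n_abelian_category M n by (rule assms(2))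
  show ?thesis
  proof
    show "\<And>X. X \<in> {X. is_n_exact M n X} \<Longrightarrow> is_n_exact M n X"
      by simp
    show "\<And>X Y F. is_weak_isomorphism M n X Y F
        \<Longrightarrow> (X \<in> {X. is_n_exact M n X}) = (Y \<in> {X. is_n_exact M n X})"
      by (simp add: is_weak_isomorphism_def)
    show "\<And>Z. is_zero_object M Z
        \<Longrightarrow> \<lparr>ob = \<lambda>_. Z, diff = \<lambda>_. \<zero>\<^bsub>mor M Z Z\<^esub>\<rparr> \<in> {X. is_n_exact M n X}"
      using zero_sequence_n_exact by simp
  qed (auto intro: adm_mono_closed adm_epi_closed ex_n_pushout[OF assms(1)] ex_n_pullback[OF assms(1)]
      simp del: One_nat_def)
qed

end
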